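(* A smooth spacetime $M$ is strongly causal if and only if the canonical map of locales $M\to M^{\triangle}\times M^{\triangledown}$ defines a sublocale.
   Context: A smooth spacetime is a connected Lorentzian manifold $(M,g)$ of dimension $\geq 2$ (signature $(-+\cdots+)$) with a time orientation. A nonzero tangent vector $v$ is causal if $g(v,v)\leq0$. A causal curve is a piecewise $C^1$ curve whose tangent vectors are all causal and future directed. $x\preccurlyeq y$ means $x=y$ or there is a causal curve from $x$ to $y$. $J^+(A)=\{y:\exists x\in A,\ x\preccurlyeq y\}$, $J^-(A)=\{y:\exists x\in A,\ y\preccurlyeq x\}$. $M$ is strongly causal if for every $x\in M$ and open $V\ni x$ there is an open $U$ with $x\in U\subseteq V$ that is causally convex ($a,b\in U$ and $a\preccurlyeq z\preccurlyeq b$ imply $z\in U$). A locale $X$ is given by a frame $\mathcal{O}X$; a map of locales $f\colon X\to Y$ is a frame homomorphism $f^{-1}\colon\mathcal{O}Y\to\mathcal{O}X$. It defines a sublocale (is an extremal monomorphism of locales) iff $f^{-1}$ is surjective. $M$ is regarded as the locale with frame $\mathcal{O}M$ of open sets, with the preorder $U\trianglelefteq V$ iff $U\subseteq J^-(V)$ and $V\subseteq J^+(U)$, and localic cones $\Uparrow U=\bigcup\{V\in\mathcal{O}M:U\trianglelefteq V\}$, $\Downarrow U=\bigcup\{W\in\mathcal{O}M:W\trianglelefteq U\}$ (one has $\Uparrow U=J^+(U)$ and $\Downarrow U=J^-(U)$ for $U$ open). The cones preserve arbitrary unions, so $\operatorname{im}(\Uparrow)$ and $\operatorname{im}(\Downarrow)$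 are subframes of $\mathcal{O}M$. The locale of futures $M^{\triangle}$ has frame $\operatorname{im}(\Uparrow)$ and the locale of pasts $M^{\triangledown}$ has frame $\operatorname{im}(\Downarrow)$; the subframe inclusions are frame maps defining maps of locales $M\to M^{\triangle}$ and $M\to M^{\triangledown}$. The canonical map $M\to M^{\triangle}\times M^{\triangledown}$ is the map into the product of locales induced by these two. *)

theory Defs
  imports "HOL-Analysis.Analysis" "HOL-Algebra.Complete_Lattice"
begin

section \<open>Smooth manifolds\<close>

text \<open>
  Points of the manifold form a type \<open>'m\<close>, whose topology is the manifold topology; the Hausdorff
  property and second countability are imposed as type classes. Charts take values in a Euclidean
  space \<open>'e\<close>. A chart \<open>(U, \<phi>)\<close> is a pair of an open set and a map which matters on \<open>U\<close> only.
\<close>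

type_synonym ('m, 'e) chart = "'m set \<times> ('m \<Rightarrow> 'e)"

text \<open>\<open>Ck_on k S f\<close>: on the open set \<open>S\<close>, all iterated directional derivatives of \<open>f\<close> up to
  order \<open>k\<close> exist and are continuous.\<close>

primrec Ck_on :: "nat \<Rightarrow> 'a::euclidean_space set \<Rightarrow> ('a \<Rightarrow> 'b::real_normed_vector) \<Rightarrow> bool" where
  "Ck_on 0 S f \<longleftrightarrow> continuous_on S f"
| "Ck_on (Suc k) S f \<longleftrightarrow>
     (\<forall>x\<in>S. f differentiable (at x)) \<and> (\<forall>v. Ck_on k S (\<lambda>x. frechet_derivative f (at x) v))"

definition smooth_on :: "'a::euclidean_space set \<Rightarrow> ('a \<Rightarrow> 'b::real_normed_vector) \<Rightarrow> bool" where
  "smooth_on S f \<longleftrightarrow> (\<forall>k. Ck_on k S f)"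

definition is_chart :: "('m::topological_space, 'e::euclidean_space) chart \<Rightarrow> bool" where
  "is_chart c \<longleftrightarrow> open (fst c) \<and> open (snd c ` fst c) \<and>
     (\<exists>\<psi>. homeomorphism (fst c) (snd c ` fst c) (snd c) \<psi>)"

definition chart_inv :: "('m, 'e) chart \<Rightarrow> 'e \<Rightarrow> 'm" where
  "chart_inv c = inv_into (fst c) (snd c)"

definition transition :: "('m, 'e) chart \<Rightarrow> ('m, 'e) chart \<Rightarrow> 'e \<Rightarrow> 'e" where
  "transition c d = snd d \<circ> chart_inv c"

definition smooth_atlas :: "('m::topological_space, 'e::euclidean_space) chart set \<Rightarrow> bool" where
  "smooth_atlas A \<longleftrightarrow> (\<forall>c\<in>A. is_chart c) \<and> (\<Union>c\<in>A. fst c) = UNIV \<and>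
     (\<forall>c\<in>A. \<forall>d\<in>A. smooth_on (snd c ` (fst c \<inter> fst d)) (transition c d))"

text \<open>
  A tangent vector at \<open>p\<close> is represented by its components in all charts of the atlas around \<open>p\<close>,
  which transform by the derivatives of the transition maps. The value is \<open>0\<close> for all other charts,
  so that equality of tangent vectors is equality of functions and the zero vector is \<open>\<lambda>_. 0\<close>.
\<close>

type_synonym ('m, 'e) tangent = "('m, 'e) chart \<Rightarrow> 'e"

definition tangent_space ::
    "('m, 'e::euclidean_space) chart set \<Rightarrow> 'm \<Rightarrow> ('m, 'e) tangent set" where
  "tangent_space A p = {v.
     (\<forall>c\<in>A. \<forall>d\<in>A. p \<in> fst c \<and> p \<in> fst d \<longrightarrow>
        v d = frechet_derivative (transition c d) (at (snd c p)) (v c)) \<and>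
     (\<forall>c. \<not> (c \<in> A \<and> p \<in> fst c) \<longrightarrow> v c = 0)}"

text \<open>The tangent vector at \<open>p\<close> whose components in the chart \<open>c\<close> are \<open>a\<close>. For a smooth atlas and a
  chart \<open>c\<close> around \<open>p\<close>, this is the linear isomorphism from \<open>'e\<close> to the tangent space.\<close>

definition coord_vector ::
    "('m, 'e::euclidean_space) chart set \<Rightarrow> ('m, 'e) chart \<Rightarrow> 'm \<Rightarrow> 'e \<Rightarrow> ('m, 'e) tangent" where
  "coord_vector A c p a = (\<lambda>d. if d \<in> A \<and> p \<in> fst d
     then frechet_derivative (transition c d) (at (snd c p)) a else 0)"


section \<open>Smooth spacetimes\<close>

text \<open>The field \<open>time_field\<close> is a continuous timelike vector field, which represents the time
  orientation: it singles out a future cone at every point.\<close>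

record ('m, 'e) spacetime =
  atlas :: "('m, 'e) chart set"
  metric :: "'m \<Rightarrow> ('m, 'e) tangent \<Rightarrow> ('m, 'e) tangent \<Rightarrow> real"
  time_field :: "'m \<Rightarrow> ('m, 'e) tangent"

text \<open>The signature of a symmetric bilinear form is \<open>(- + \<dots> +)\<close>: some linear isomorphism \<open>L\<close> takes
  the standard basis to an orthonormal basis with exactly one timelike member \<open>L b\<close>.\<close>

definition lorentzian_form :: "('e::euclidean_space \<Rightarrow> 'e \<Rightarrow> real) \<Rightarrow> bool" where
  "lorentzian_form G \<longleftrightarrow> bilinear G \<and> (\<forall>u v. G u v = G v u) \<and>
     (\<exists>L :: 'e \<Rightarrow> 'e. linear L \<and> bij L \<and> (\<exists>b\<in>Basis. \<forall>i\<in>Basis. \<forall>j\<in>Basis.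
        G (L i) (L j) = (if i \<noteq> j then 0 else if i = b then - 1 else 1)))"

definition lorentzian_metric ::
    "('m, 'e::euclidean_space) chart set \<Rightarrow>
     ('m \<Rightarrow> ('m, 'e) tangent \<Rightarrow> ('m, 'e) tangent \<Rightarrow> real) \<Rightarrow> bool" where
  "lorentzian_metric A g \<longleftrightarrow> (\<forall>c\<in>A.
     (\<forall>p\<in>fst c. lorentzian_form (\<lambda>a b. g p (coord_vector A c p a) (coord_vector A c p b))) \<and>
     (\<forall>a b. smooth_on (snd c ` fst c)
        (\<lambda>x. let p = chart_inv c x in g p (coord_vector A c p a) (coord_vector A c p b))))"

definition time_orientation ::
    "('m::topological_space, 'e::euclidean_space) chart set \<Rightarrow>
     ('m \<Rightarrow> ('m, 'e) tangent \<Rightarrow> ('m, 'e) tangent \<Rightarrow> real) \<Rightarrow> ('m \<Rightarrow> ('m, 'e) tangent) \<Rightarrow> bool" where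
  "time_orientation A g \<tau> \<longleftrightarrow>
     (\<forall>p. \<tau> p \<in> tangent_space A p \<and> g p (\<tau> p) (\<tau> p) < 0) \<and>
     (\<forall>c\<in>A. continuous_on (fst c) (\<lambda>p. \<tau> p c))"

definition smooth_spacetime ::
    "('m::{t2_space,second_countable_topology}, 'e::euclidean_space) spacetime \<Rightarrow> bool" where
  "smooth_spacetime M \<longleftrightarrow> connected (UNIV :: 'm set) \<and> DIM('e) \<ge> 2 \<and>
     smooth_atlas (atlas M) \<and> lorentzian_metric (atlas M) (metric M) \<and>
     time_orientation (atlas M) (metric M) (time_field M)"


section \<open>Causality\<close>

definition causal_vector ::
    "('m, 'e::euclidean_space) spacetime \<Rightarrow> 'm \<Rightarrow> ('m, 'e) tangent \<Rightarrow> bool" where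
  "causal_vector M p v \<longleftrightarrow> v \<in> tangent_space (atlas M) p \<and> v \<noteq> (\<lambda>_. 0) \<and> metric M p v v \<le> 0"

text \<open>In signature \<open>(- + \<dots> +)\<close>, a causal vector lies in the same cone as the timelike vector
  \<open>time_field M p\<close> iff their product is negative.\<close>

definition future_directed ::
    "('m, 'e::euclidean_space) spacetime \<Rightarrow> 'm \<Rightarrow> ('m, 'e) tangent \<Rightarrow> bool" where
  "future_directed M p v \<longleftrightarrow> metric M p v (time_field M p) < 0"

text \<open>\<open>v\<close> is the velocity of the \<open>C\<^sup>1\<close> curve \<open>\<gamma>\<close> on \<open>[a, b]\<close>, one-sided at the end points.\<close>

definition C1_curve ::
    "('m::topological_space, 'e::euclidean_space) spacetime \<Rightarrow> real \<Rightarrow> real \<Rightarrow> (real \<Rightarrow> 'm) \<Rightarrow>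
     (real \<Rightarrow> ('m, 'e) tangent) \<Rightarrow> bool" where
  "C1_curve M a b \<gamma> v \<longleftrightarrow> continuous_on {a..b} \<gamma> \<and>
     (\<forall>t\<in>{a..b}. v t \<in> tangent_space (atlas M) (\<gamma> t)) \<and>
     (\<forall>c\<in>atlas M.
        (\<forall>t\<in>{a..b}. \<gamma> t \<in> fst c \<longrightarrow>
           ((\<lambda>s. snd c (\<gamma> s)) has_vector_derivative v t c) (at t within {a..b})) \<and>
        continuous_on {t\<in>{a..b}. \<gamma> t \<in> fst c} (\<lambda>t. v t c))"

text \<open>The list \<open>ts\<close> is a subdivision of the parameter interval, such that \<open>\<gamma>\<close> is \<open>C\<^sup>1\<close> on each of the
  closed pieces. In particular both one-sided tangents at a break point are causal and future
  directed.\<close>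

definition causal_curve ::
    "('m::topological_space, 'e::euclidean_space) spacetime \<Rightarrow> real \<Rightarrow> real \<Rightarrow> (real \<Rightarrow> 'm) \<Rightarrow> bool"
    where
  "causal_curve M a b \<gamma> \<longleftrightarrow> (\<exists>ts. sorted_wrt (<) ts \<and> length ts \<ge> 2 \<and> hd ts = a \<and> last ts = b \<and>
     (\<forall>i. Suc i < length ts \<longrightarrow>
        (\<exists>v. C1_curve M (ts ! i) (ts ! Suc i) \<gamma> v \<and>
           (\<forall>t\<in>{ts ! i..ts ! Suc i}. causal_vector M (\<gamma> t) (v t) \<and> future_directed M (\<gamma> t) (v t)))))"

definition causal_le ::
    "('m::topological_space, 'e::euclidean_space) spacetime \<Rightarrow> 'm \<Rightarrow> 'm \<Rightarrow> bool" where
  "causal_le M x y \<longleftrightarrow> x = y \<or> (\<exists>a b \<gamma>. causal_curve M a b \<gamma> \<and> \<gamma> a = x \<and> \<gamma> b = y)"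

definition J_plus ::
    "('m::topological_space, 'e::euclidean_space) spacetime \<Rightarrow> 'm set \<Rightarrow> 'm set" where
  "J_plus M A = {y. \<exists>x\<in>A. causal_le M x y}"

definition J_minus ::
    "('m::topological_space, 'e::euclidean_space) spacetime \<Rightarrow> 'm set \<Rightarrow> 'm set" where
  "J_minus M A = {y. \<exists>x\<in>A. causal_le M y x}"

definition causally_convex ::
    "('m::topological_space, 'e::euclidean_space) spacetime \<Rightarrow> 'm set \<Rightarrow> bool" where
  "causally_convex M U \<longleftrightarrow> (\<forall>a\<in>U. \<forall>b\<in>U. \<forall>z. causal_le M a z \<and> causal_le M z b \<longrightarrow> z \<in> U)"

definition strongly_causal ::
    "('m::topological_space, 'e::euclidean_space) spacetime \<Rightarrow> bool" where
  "strongly_causal M \<longleftrightarrow> (\<forall>x V. open V \<and> x \<in> V \<longrightarrow>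
     (\<exists>U. open U \<and> x \<in> U \<and> U \<subseteq> V \<and> causally_convex M U))"


section \<open>Frames and locales\<close>

locale frame = complete_lattice L for L (structure) +
  assumes meet_Sup: "x \<in> carrier L \<Longrightarrow> A \<subseteq> carrier L \<Longrightarrow> x \<sqinter> \<Squnion>A = \<Squnion>((\<lambda>a. x \<sqinter> a) ` A)"

definition frame_hom :: "'a gorder \<Rightarrow> 'b gorder \<Rightarrow> ('a \<Rightarrow> 'b) set" where
  "frame_hom L K = {h \<in> carrier L \<rightarrow> carrier K.
     (\<forall>A \<subseteq> carrier L. h (\<Squnion>\<^bsub>L\<^esub>A) = \<Squnion>\<^bsub>K\<^esub>(h ` A)) \<and>
     (\<forall>x\<in>carrier L. \<forall>y\<in>carrier L. h (x \<sqinter>\<^bsub>L\<^esub> y) = h x \<sqinter>\<^bsub>K\<^esub> h y) \<and>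
     h \<top>\<^bsub>L\<^esub> = \<top>\<^bsub>K\<^esub>}"

text \<open>A locale is given by its frame, and a map of locales from \<open>X\<close> to \<open>Y\<close> by its inverse image
  map \<open>f\<close>, which goes from the frame of \<open>Y\<close> to the frame of \<open>X\<close>.\<close>

definition locale_map :: "'a gorder \<Rightarrow> 'b gorder \<Rightarrow> ('b \<Rightarrow> 'a) \<Rightarrow> bool" where
  "locale_map X Y f \<longleftrightarrow> frame X \<and> frame Y \<and> f \<in> frame_hom Y X"

definition defines_sublocale :: "'a gorder \<Rightarrow> 'b gorder \<Rightarrow> ('b \<Rightarrow> 'a) \<Rightarrow> bool" where
  "defines_sublocale X Y f \<longleftrightarrow> locale_map X Y f \<and> f ` carrier Y = carrier X"

definition inclusion_order :: "'a set set \<Rightarrow> 'a set gorder" where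
  "inclusion_order S = \<lparr>carrier = S, eq = (=), le = (\<subseteq>)\<rparr>"

text \<open>
  The product of the locales \<open>L\<close> and \<open>K\<close> has as frame the coproduct of the frames, which is
  constructed as the set of C-ideals: down-closed subsets of \<open>L \<times> K\<close> which are closed under suprema
  (the empty one included) in each component separately. Its universal property is proved in
  \<open>locale_prod_universal\<close> below.
\<close>

definition C_ideals :: "'a gorder \<Rightarrow> 'b gorder \<Rightarrow> ('a \<times> 'b) set set" where
  "C_ideals L K = {D. D \<subseteq> carrier L \<times> carrier K \<and>
     (\<forall>x y x' y'. (x, y) \<in> D \<and> x' \<in> carrier L \<and> y' \<in> carrier K \<and>
        x' \<sqsubseteq>\<^bsub>L\<^esub> x \<and> y' \<sqsubseteq>\<^bsub>K\<^esub> y \<longrightarrow> (x', y') \<in> D) \<and>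
     (\<forall>A y. A \<subseteq> carrier L \<and> y \<in> carrier K \<and> (\<forall>a\<in>A. (a, y) \<in> D) \<longrightarrow> (\<Squnion>\<^bsub>L\<^esub>A, y) \<in> D) \<and>
     (\<forall>x B. x \<in> carrier L \<and> B \<subseteq> carrier K \<and> (\<forall>b\<in>B. (x, b) \<in> D) \<longrightarrow> (x, \<Squnion>\<^bsub>K\<^esub>B) \<in> D)}"

definition locale_prod :: "'a gorder \<Rightarrow> 'b gorder \<Rightarrow> ('a \<times> 'b) set gorder" where
  "locale_prod L K = inclusion_order (C_ideals L K)"

definition open_rectangle :: "'a gorder \<Rightarrow> 'b gorder \<Rightarrow> 'a \<Rightarrow> 'b \<Rightarrow> ('a \<times> 'b) set" where
  "open_rectangle L K a b = \<Inter>{D \<in> C_ideals L K. (a, b) \<in> D}"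

text \<open>The inverse image maps of the two projections.\<close>

definition proj1_inv :: "'a gorder \<Rightarrow> 'b gorder \<Rightarrow> 'a \<Rightarrow> ('a \<times> 'b) set" where
  "proj1_inv L K a = open_rectangle L K a \<top>\<^bsub>K\<^esub>"

definition proj2_inv :: "'a gorder \<Rightarrow> 'b gorder \<Rightarrow> 'b \<Rightarrow> ('a \<times> 'b) set" where
  "proj2_inv L K b = open_rectangle L K \<top>\<^bsub>L\<^esub> b"

text \<open>\<open>is_pairing X L K f g h\<close>: the map \<open>h\<close> from \<open>X\<close> to \<open>L \<times> K\<close> composes with the projections to \<open>f\<close>
  and \<open>g\<close>. Extensionality makes \<open>h\<close> unique as a HOL function.\<close>

definition is_pairing ::
    "'c gorder \<Rightarrow> 'a gorder \<Rightarrow> 'b gorder \<Rightarrow> ('a \<Rightarrow> 'c) \<Rightarrow> ('b \<Rightarrow> 'c) \<Rightarrow> (('a \<times> 'b) set \<Rightarrow> 'c) \<Rightarrow> bool"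
    where
  "is_pairing X L K f g h \<longleftrightarrow>
     locale_map X (locale_prod L K) h \<and> h \<in> extensional (carrier (locale_prod L K)) \<and>
     (\<forall>a\<in>carrier L. h (proj1_inv L K a) = f a) \<and> (\<forall>b\<in>carrier K. h (proj2_inv L K b) = g b)"

definition locale_pairing ::
    "'c gorder \<Rightarrow> 'a gorder \<Rightarrow> 'b gorder \<Rightarrow> ('a \<Rightarrow> 'c) \<Rightarrow> ('b \<Rightarrow> 'c) \<Rightarrow> ('a \<times> 'b) set \<Rightarrow> 'c" where
  "locale_pairing X L K f g = (THE h. is_pairing X L K f g h)"

lemma partial_order_inclusion_order: "partial_order (inclusion_order S)"
  by standard (auto simp: inclusion_order_def)

lemma (in complete_lattice) Sup_eqI:
  assumes "A \<subseteq> carrier L" "s \<in> carrier L" "\<And>a. a \<in> A \<Longrightarrow> a \<sqsubseteq> s"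
    "\<And>z. z \<in> carrier L \<Longrightarrow> (\<And>a. a \<in> A \<Longrightarrow> a \<sqsubseteq> z) \<Longrightarrow> s \<sqsubseteq> z"
  shows "\<Squnion>A = s"
  proof (rule le_antisym)
  show "\<Squnion>A \<sqsubseteq> s" using assms by (intro sup_least) auto
  show "s \<sqsubseteq> \<Squnion>A" using assms by (intro assms(4) sup_upper) auto
qed (use assms in auto)

lemma (in complete_lattice) meet_eqI:
  assumes "x \<in> carrier L" "y \<in> carrier L" "m \<in> carrier L" "m \<sqsubseteq> x" "m \<sqsubseteq> y"
    "\<And>z. z \<in> carrier L \<Longrightarrow> z \<sqsubseteq> x \<Longrightarrow> z \<sqsubseteq> y \<Longrightarrow> z \<sqsubseteq> m"
  shows "x \<sqinter> y = m"
  proof (rule le_antisym)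
  show "x \<sqinter> y \<sqsubseteq> m" using assms by (intro assms(6) meet_left meet_right) auto
  show "m \<sqsubseteq> x \<sqinter> y" using assms by (intro meet_le) auto
qed (use assms in auto)

lemma (in complete_lattice) meet_mono:
  assumes "x \<in> carrier L" "y \<in> carrier L" "x' \<in> carrier L" "y' \<in> carrier L" "x \<sqsubseteq> x'" "y \<sqsubseteq> y'"
  shows "x \<sqinter> y \<sqsubseteq> x' \<sqinter> y'"
proof (rule meet_le)
  show "x \<sqinter> y \<sqsubseteq> x'" using le_trans[OF meet_left[of x y] assms(5)] assms by auto
  show "x \<sqinter> y \<sqsubseteq> y'" using le_trans[OF meet_right[of x y] assms(6)] assms by auto
qed (use assms in auto)

lemma (in frame) Sup_meet:
  assumes "x \<in> carrier L" "A \<subseteq> carrier L"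
  shows "\<Squnion>A \<sqinter> x = \<Squnion>((\<lambda>a. a \<sqinter> x) ` A)"
proof -
  have "(\<lambda>a. a \<sqinter> x) ` A = (\<lambda>a. x \<sqinter> a) ` A"
    by (rule image_cong) (auto simp: meet_comm)
  then show ?thesis using meet_Sup[OF assms] by (simp add: meet_comm)
qed

locale frame_pair = L: frame L + K: frame K for L :: "'a gorder" and K :: "'b gorder"
begin

abbreviation "P \<equiv> locale_prod L K"
abbreviation "tens \<equiv> open_rectangle L K"

lemma carrier_P [simp]: "carrier P = C_ideals L K"
  and le_P [simp]: "D \<sqsubseteq>\<^bsub>P\<^esub> E \<longleftrightarrow> D \<subseteq> E"
  by (auto simp: locale_prod_def inclusion_order_def)

lemma C_ideal_sub: "D \<in> C_ideals L K \<Longrightarrow> D \<subseteq> carrier L \<times> carrier K"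
  by (auto simp: C_ideals_def)

lemma C_ideal_down: "D \<in> C_ideals L K \<Longrightarrow> (x, y) \<in> D \<Longrightarrow> x' \<in> carrier L \<Longrightarrow> y' \<in> carrier K \<Longrightarrow>
    x' \<sqsubseteq>\<^bsub>L\<^esub> x \<Longrightarrow> y' \<sqsubseteq>\<^bsub>K\<^esub> y \<Longrightarrow> (x', y') \<in> D"
  unfolding C_ideals_def mem_Collect_eq by (elim conjE) (meson)

lemma C_ideal_Sup1: "D \<in> C_ideals L K \<Longrightarrow> A \<subseteq> carrier L \<Longrightarrow> y \<in> carrier K \<Longrightarrow>
    (\<And>a. a \<in> A \<Longrightarrow> (a, y) \<in> D) \<Longrightarrow> (\<Squnion>\<^bsub>L\<^esub>A, y) \<in> D"
  unfolding C_ideals_def mem_Collect_eq by (elim conjE) (metis (no_types, lifting))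

lemma C_ideal_Sup2: "D \<in> C_ideals L K \<Longrightarrow> B \<subseteq> carrier K \<Longrightarrow> x \<in> carrier L \<Longrightarrow>
    (\<And>b. b \<in> B \<Longrightarrow> (x, b) \<in> D) \<Longrightarrow> (x, \<Squnion>\<^bsub>K\<^esub>B) \<in> D"
  unfolding C_ideals_def mem_Collect_eq by (elim conjE) (metis (no_types, lifting))

lemma C_idealI:
  assumes "D \<subseteq> carrier L \<times> carrier K"
    "\<And>x y x' y'. (x, y) \<in> D \<Longrightarrow> x' \<in> carrier L \<Longrightarrow> y' \<in> carrier K \<Longrightarrow>
        x' \<sqsubseteq>\<^bsub>L\<^esub> x \<Longrightarrow> y' \<sqsubseteq>\<^bsub>K\<^esub> y \<Longrightarrow> (x', y') \<in> D"
    "\<And>A y. A \<subseteq> carrier L \<Longrightarrow> y \<in> carrier K \<Longrightarrow> (\<And>a. a \<in> A \<Longrightarrow> (a, y) \<in> D) \<Longrightarrow> (\<Squnion>\<^bsub>L\<^esub>A, y) \<in> D"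
    "\<And>x B. x \<in> carrier L \<Longrightarrow> B \<subseteq> carrier K \<Longrightarrow> (\<And>b. b \<in> B \<Longrightarrow> (x, b) \<in> D) \<Longrightarrow> (x, \<Squnion>\<^bsub>K\<^esub>B) \<in> D"
  shows "D \<in> C_ideals L K"
  unfolding C_ideals_def mem_Collect_eq
  by (intro conjI allI impI; (elim conjE)?) (auto intro: assms(2-4) dest: assms(1)[THEN subsetD])

lemma C_ideal_Inter:
  assumes "\<D> \<subseteq> C_ideals L K"
  shows "carrier L \<times> carrier K \<inter> \<Inter>\<D> \<in> C_ideals L K"
proof (rule C_idealI)
  fix x y x' y'
  assume "(x, y) \<in> carrier L \<times> carrier K \<inter> \<Inter>\<D>" "x' \<in> carrier L" "y' \<in> carrier K"
    "x' \<sqsubseteq>\<^bsub>L\<^esub> x" "y' \<sqsubseteq>\<^bsub>K\<^esub> y"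
  then show "(x', y') \<in> carrier L \<times> carrier K \<inter> \<Inter>\<D>"
    using assms C_ideal_down by blast
next
  fix A y
  assume "A \<subseteq> carrier L" "y \<in> carrier K" "\<And>a. a \<in> A \<Longrightarrow> (a, y) \<in> carrier L \<times> carrier K \<inter> \<Inter>\<D>"
  then show "(\<Squnion>\<^bsub>L\<^esub>A, y) \<in> carrier L \<times> carrier K \<inter> \<Inter>\<D>"
    using assms by (auto intro!: C_ideal_Sup1)
next
  fix x B
  assume "x \<in> carrier L" "B \<subseteq> carrier K" "\<And>b. b \<in> B \<Longrightarrow> (x, b) \<in> carrier L \<times> carrier K \<inter> \<Inter>\<D>"
  then show "(x, \<Squnion>\<^bsub>K\<^esub>B) \<in> carrier L \<times> carrier K \<inter> \<Inter>\<D>"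
    using assms by (auto intro!: C_ideal_Sup2)
qed auto

lemma C_ideal_top: "carrier L \<times> carrier K \<in> C_ideals L K"
  using C_ideal_Inter[of "{}"] by simp

lemma C_ideal_Inter': "\<D> \<subseteq> C_ideals L K \<Longrightarrow> \<D> \<noteq> {} \<Longrightarrow> \<Inter>\<D> \<in> C_ideals L K"
  using C_ideal_Inter[of \<D>] C_ideal_sub
  by (metis Inf_lower2 Int_absorb1 all_not_in_conv subsetD)

lemma C_ideal_Int: "D \<in> C_ideals L K \<Longrightarrow> E \<in> C_ideals L K \<Longrightarrow> D \<inter> E \<in> C_ideals L K"
  using C_ideal_Inter'[of "{D, E}"] by simp

sublocale P: complete_lattice P
proof -
  interpret partial_order P
    unfolding locale_prod_def by (rule partial_order_inclusion_order)
  show "complete_lattice P"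
  proof (rule complete_lattice_criterion1)
    show "\<exists>g. greatest P g (carrier P)"
      using C_ideal_top C_ideal_sub by (intro exI[of _ "carrier L \<times> carrier K"]) (auto simp: greatest_def)
    fix \<D> assume "\<D> \<subseteq> carrier P" "\<D> \<noteq> {}"
    then show "\<exists>i. greatest P i (Lower P \<D>)"
      using C_ideal_Inter'[of \<D>]
      by (intro exI[of _ "\<Inter>\<D>"]) (auto simp: greatest_def Lower_def)
  qed
qed

lemma meet_P: "D \<in> C_ideals L K \<Longrightarrow> E \<in> C_ideals L K \<Longrightarrow> D \<sqinter>\<^bsub>P\<^esub> E = D \<inter> E"
  by (rule P.meet_eqI) (auto intro: C_ideal_Int)

lemma top_P: "\<top>\<^bsub>P\<^esub> = carrier L \<times> carrier K"
  using C_ideal_sub[of "\<top>\<^bsub>P\<^esub>"] P.top_closed P.top_higher[of "carrier L \<times> carrier K"] C_ideal_top by auto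

lemma frame_P: "frame P"
proof
  fix D \<D> assume D: "D \<in> carrier P" and \<D>: "\<D> \<subseteq> carrier P"
  define F where "F = \<Squnion>\<^bsub>P\<^esub>((\<lambda>E. D \<sqinter>\<^bsub>P\<^esub> E) ` \<D>)"
  have sub: "(\<lambda>E. D \<sqinter>\<^bsub>P\<^esub> E) ` \<D> \<subseteq> carrier P"
    using D \<D> by (auto simp: meet_P subset_iff intro: C_ideal_Int)
  have F: "F \<in> C_ideals L K"
    using P.sup_closed[OF sub] by (simp add: F_def)
  have Fu: "D \<inter> E \<subseteq> F" if "E \<in> \<D>" for E
    using P.sup_upper[OF sub imageI[OF that]] that D \<D> meet_P[of D E] by (auto simp: F_def)
  define G where "G = {(x, y) \<in> carrier L \<times> carrier K. \<forall>(d, e)\<in>D. (x \<sqinter>\<^bsub>L\<^esub> d, y \<sqinter>\<^bsub>K\<^esub> e) \<in> F}"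
  have Dc: "d \<in> carrier L \<and> e \<in> carrier K" if "(d, e) \<in> D" for d e
    using C_ideal_sub[of D] D that by auto
  have G: "G \<in> C_ideals L K"
  proof (rule C_idealI)
    fix x y x' y'
    assume h: "(x, y) \<in> G" "x' \<in> carrier L" "y' \<in> carrier K" "x' \<sqsubseteq>\<^bsub>L\<^esub> x" "y' \<sqsubseteq>\<^bsub>K\<^esub> y"
    have "(x' \<sqinter>\<^bsub>L\<^esub> d, y' \<sqinter>\<^bsub>K\<^esub> e) \<in> F" if "(d, e) \<in> D" for d e
    proof (rule C_ideal_down[OF F])
      show "(x \<sqinter>\<^bsub>L\<^esub> d, y \<sqinter>\<^bsub>K\<^esub> e) \<in> F" using h(1) that by (auto simp: G_def)
    qed (use h Dc[OF that] in \<open>auto simp: G_def intro!: L.meet_mono K.meet_mono\<close>)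
    then show "(x', y') \<in> G" using h by (auto simp: G_def)
  next
    fix A y
    assume h: "A \<subseteq> carrier L" "y \<in> carrier K" "\<And>a. a \<in> A \<Longrightarrow> (a, y) \<in> G"
    have "(\<Squnion>\<^bsub>L\<^esub>A \<sqinter>\<^bsub>L\<^esub> d, y \<sqinter>\<^bsub>K\<^esub> e) \<in> F" if "(d, e) \<in> D" for d e
      unfolding L.Sup_meet[OF conjunct1[OF Dc[OF that]] h(1)]
      by (rule C_ideal_Sup1[OF F]) (use h Dc[OF that] that in \<open>force simp: G_def\<close>)+
    then show "(\<Squnion>\<^bsub>L\<^esub>A, y) \<in> G" using h by (auto simp: G_def)
  next
    fix x B
    assume h: "x \<in> carrier L" "B \<subseteq> carrier K" "\<And>b. b \<in> B \<Longrightarrow> (x, b) \<in> G"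
    have "(x \<sqinter>\<^bsub>L\<^esub> d, \<Squnion>\<^bsub>K\<^esub>B \<sqinter>\<^bsub>K\<^esub> e) \<in> F" if "(d, e) \<in> D" for d e
      unfolding K.Sup_meet[OF conjunct2[OF Dc[OF that]] h(2)]
      by (rule C_ideal_Sup2[OF F]) (use h Dc[OF that] that in \<open>force simp: G_def\<close>)+
    then show "(x, \<Squnion>\<^bsub>K\<^esub>B) \<in> G" using h by (auto simp: G_def)
  qed (auto simp: G_def)
  have "E \<subseteq> G" if "E \<in> \<D>" for E
  proof clarify
    fix x y assume xy: "(x, y) \<in> E"
    have E: "E \<in> C_ideals L K" using that \<D> by auto
    have c: "x \<in> carrier L" "y \<in> carrier K" using xy C_ideal_sub[OF E] by auto
    have "(x \<sqinter>\<^bsub>L\<^esub> d, y \<sqinter>\<^bsub>K\<^esub> e) \<in> F" if de: "(d, e) \<in> D" for d e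
    proof -
      have "(x \<sqinter>\<^bsub>L\<^esub> d, y \<sqinter>\<^bsub>K\<^esub> e) \<in> E"
        by (rule C_ideal_down[OF E xy]) (use c Dc[OF de] in \<open>auto intro: L.meet_left K.meet_left\<close>)
      moreover have "(x \<sqinter>\<^bsub>L\<^esub> d, y \<sqinter>\<^bsub>K\<^esub> e) \<in> D"
        by (rule C_ideal_down[OF _ de]) (use D c Dc[OF de] in \<open>auto intro: L.meet_right K.meet_right\<close>)
      ultimately show ?thesis using Fu[OF \<open>E \<in> \<D>\<close>] by auto
    qed
    then show "(x, y) \<in> G" using c by (auto simp: G_def)
  qed
  then have SG: "\<Squnion>\<^bsub>P\<^esub>\<D> \<subseteq> G"
    using P.sup_least[OF \<D>, of G] G by auto
  have S: "\<Squnion>\<^bsub>P\<^esub>\<D> \<in> C_ideals L K"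
    using P.sup_closed[OF \<D>] by simp
  have "D \<inter> \<Squnion>\<^bsub>P\<^esub>\<D> \<subseteq> F"
  proof clarify
    fix x y assume "(x, y) \<in> D" "(x, y) \<in> \<Squnion>\<^bsub>P\<^esub>\<D>"
    then have "(x \<sqinter>\<^bsub>L\<^esub> x, y \<sqinter>\<^bsub>K\<^esub> y) \<in> F" using SG by (auto simp: G_def)
    moreover have "x \<sqinter>\<^bsub>L\<^esub> x = x" "y \<sqinter>\<^bsub>K\<^esub> y = y"
      using Dc[OF \<open>(x, y) \<in> D\<close>] by (auto intro!: L.meet_eqI K.meet_eqI)
    ultimately show "(x, y) \<in> F" by simp
  qed
  moreover have "F \<subseteq> D \<inter> \<Squnion>\<^bsub>P\<^esub>\<D>"
  proof -
    have "F \<sqsubseteq>\<^bsub>P\<^esub> D \<inter> \<Squnion>\<^bsub>P\<^esub>\<D>"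
      unfolding F_def
    proof (rule P.sup_least[OF sub])
      fix z assume "z \<in> (\<lambda>E. D \<sqinter>\<^bsub>P\<^esub> E) ` \<D>"
      then obtain E where E: "E \<in> \<D>" "z = D \<inter> E" using D \<D> by (auto simp: meet_P)
      then show "z \<sqsubseteq>\<^bsub>P\<^esub> D \<inter> \<Squnion>\<^bsub>P\<^esub>\<D>" using P.sup_upper[OF \<D> E(1)] by auto
    qed (use C_ideal_Int D S in auto)
    then show ?thesis by simp
  qed
  ultimately show "D \<sqinter>\<^bsub>P\<^esub> \<Squnion>\<^bsub>P\<^esub>\<D> = \<Squnion>\<^bsub>P\<^esub>((\<lambda>E. D \<sqinter>\<^bsub>P\<^esub> E) ` \<D>)"
    using meet_P[OF _ S] D by (auto simp: F_def[symmetric])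
qed

lemma rect_closed: "a \<in> carrier L \<Longrightarrow> b \<in> carrier K \<Longrightarrow> tens a b \<in> C_ideals L K"
  unfolding open_rectangle_def using C_ideal_top by (intro C_ideal_Inter') auto

lemma rect_mem: "(a, b) \<in> tens a b"
  by (auto simp: open_rectangle_def)

lemma rect_least: "D \<in> C_ideals L K \<Longrightarrow> (a, b) \<in> D \<Longrightarrow> tens a b \<subseteq> D"
  by (auto simp: open_rectangle_def)

lemma rect_subset_iff:
  "D \<in> C_ideals L K \<Longrightarrow> tens a b \<subseteq> D \<longleftrightarrow> (a, b) \<in> D"
  using rect_mem rect_least by blast

lemma rect_mono:
  assumes "a \<in> carrier L" "b \<in> carrier K" "a' \<in> carrier L" "b' \<in> carrier K"
    "a \<sqsubseteq>\<^bsub>L\<^esub> a'" "b \<sqsubseteq>\<^bsub>K\<^esub> b'"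
  shows "tens a b \<subseteq> tens a' b'"
  using assms C_ideal_down[OF rect_closed rect_mem, of a' b' a b] by (intro rect_least rect_closed) auto

lemma rect_Int:
  assumes a: "a \<in> carrier L" "a' \<in> carrier L" and b: "b \<in> carrier K" "b' \<in> carrier K"
  shows "tens a b \<inter> tens a' b' = tens (a \<sqinter>\<^bsub>L\<^esub> a') (b \<sqinter>\<^bsub>K\<^esub> b')"
proof
  define R where "R = tens (a \<sqinter>\<^bsub>L\<^esub> a') (b \<sqinter>\<^bsub>K\<^esub> b')"
  have R: "R \<in> C_ideals L K" unfolding R_def using a b by (intro rect_closed) auto
  text \<open>Closing up one factor at a time.\<close>
  have step: "{(x, y) \<in> carrier L \<times> carrier K. (x \<sqinter>\<^bsub>L\<^esub> u, y \<sqinter>\<^bsub>K\<^esub> v) \<in> R} \<in> C_ideals L K"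
    (is "?S \<in> _") if u: "u \<in> carrier L" and v: "v \<in> carrier K" for u v
  proof (rule C_idealI)
    fix x y x' y'
    assume h: "(x, y) \<in> ?S" "x' \<in> carrier L" "y' \<in> carrier K" "x' \<sqsubseteq>\<^bsub>L\<^esub> x" "y' \<sqsubseteq>\<^bsub>K\<^esub> y"
    have "(x' \<sqinter>\<^bsub>L\<^esub> u, y' \<sqinter>\<^bsub>K\<^esub> v) \<in> R"
    proof (rule C_ideal_down[OF R])
      show "(x \<sqinter>\<^bsub>L\<^esub> u, y \<sqinter>\<^bsub>K\<^esub> v) \<in> R" using h by auto
    qed (use h u v in \<open>auto intro!: L.meet_mono K.meet_mono\<close>)
    then show "(x', y') \<in> ?S" using h by auto
  next
    fix A y
    assume h: "A \<subseteq> carrier L" "y \<in> carrier K" "\<And>a. a \<in> A \<Longrightarrow> (a, y) \<in> ?S"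
    have "(\<Squnion>\<^bsub>L\<^esub>A \<sqinter>\<^bsub>L\<^esub> u, y \<sqinter>\<^bsub>K\<^esub> v) \<in> R"
      unfolding L.Sup_meet[OF u h(1)]
      by (rule C_ideal_Sup1[OF R]) (use h u v in auto)
    then show "(\<Squnion>\<^bsub>L\<^esub>A, y) \<in> ?S" using h by auto
  next
    fix x B
    assume h: "x \<in> carrier L" "B \<subseteq> carrier K" "\<And>b. b \<in> B \<Longrightarrow> (x, b) \<in> ?S"
    have "(x \<sqinter>\<^bsub>L\<^esub> u, \<Squnion>\<^bsub>K\<^esub>B \<sqinter>\<^bsub>K\<^esub> v) \<in> R"
      unfolding K.Sup_meet[OF v h(2)]
      by (rule C_ideal_Sup2[OF R]) (use h u v in auto)
    then show "(x, \<Squnion>\<^bsub>K\<^esub>B) \<in> ?S" using h by auto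
  qed auto
  have 1: "(x \<sqinter>\<^bsub>L\<^esub> a', y \<sqinter>\<^bsub>K\<^esub> b') \<in> R" if "(x, y) \<in> tens a b" for x y
  proof -
    have "tens a b \<subseteq> {(x, y) \<in> carrier L \<times> carrier K. (x \<sqinter>\<^bsub>L\<^esub> a', y \<sqinter>\<^bsub>K\<^esub> b') \<in> R}"
      using a b rect_mem by (intro rect_least step) (auto simp: R_def)
    with that show ?thesis by auto
  qed
  show "tens a b \<inter> tens a' b' \<subseteq> tens (a \<sqinter>\<^bsub>L\<^esub> a') (b \<sqinter>\<^bsub>K\<^esub> b')"
  proof clarify
    fix x y assume xy: "(x, y) \<in> tens a b" "(x, y) \<in> tens a' b'"
    have c: "x \<in> carrier L" "y \<in> carrier K"
      using xy C_ideal_sub[OF rect_closed, of a b] a b by auto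
    have "tens a' b' \<subseteq> {(x', y') \<in> carrier L \<times> carrier K. (x' \<sqinter>\<^bsub>L\<^esub> x, y' \<sqinter>\<^bsub>K\<^esub> y) \<in> R}"
      using a b c 1[OF xy(1)]
      by (intro rect_least step) (auto simp: meet_comm[of L a'] meet_comm[of K b'])
    with xy(2) have "(x \<sqinter>\<^bsub>L\<^esub> x, y \<sqinter>\<^bsub>K\<^esub> y) \<in> R" by auto
    moreover have "x \<sqinter>\<^bsub>L\<^esub> x = x" "y \<sqinter>\<^bsub>K\<^esub> y = y"
      using c by (auto intro!: L.meet_eqI K.meet_eqI)
    ultimately show "(x, y) \<in> tens (a \<sqinter>\<^bsub>L\<^esub> a') (b \<sqinter>\<^bsub>K\<^esub> b')" by (simp add: R_def)
  qed
  show "tens (a \<sqinter>\<^bsub>L\<^esub> a') (b \<sqinter>\<^bsub>K\<^esub> b') \<subseteq> tens a b \<inter> tens a' b'"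
    using a b by (intro Int_greatest rect_mono L.meet_left L.meet_right K.meet_left K.meet_right) simp_all
qed

lemma C_ideal_eq_Sup: "D \<in> C_ideals L K \<Longrightarrow> D = \<Squnion>\<^bsub>P\<^esub>((\<lambda>(a, b). tens a b) ` D)"
proof (rule sym, rule P.Sup_eqI)
  assume D: "D \<in> C_ideals L K"
  then show "(\<lambda>(a, b). tens a b) ` D \<subseteq> carrier P"
    using C_ideal_sub[OF D] by (auto intro!: rect_closed)
  fix z assume "z \<in> carrier P" and u: "\<And>a. a \<in> (\<lambda>(a, b). tens a b) ` D \<Longrightarrow> a \<sqsubseteq>\<^bsub>P\<^esub> z"
  show "D \<sqsubseteq>\<^bsub>P\<^esub> z"
    using u rect_mem by fastforce
qed (auto dest: rect_least)

lemma rect_eq_meet: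
  assumes "a \<in> carrier L" "b \<in> carrier K"
  shows "tens a b = proj1_inv L K a \<sqinter>\<^bsub>P\<^esub> proj2_inv L K b"
proof -
  have "a \<sqinter>\<^bsub>L\<^esub> \<top>\<^bsub>L\<^esub> = a" "\<top>\<^bsub>K\<^esub> \<sqinter>\<^bsub>K\<^esub> b = b"
    using assms by (auto intro!: L.meet_eqI K.meet_eqI L.top_higher K.top_higher)
  then show ?thesis
    using assms unfolding proj1_inv_def proj2_inv_def
    by (simp add: meet_P rect_closed rect_Int)
qed

lemma rect_top: "tens \<top>\<^bsub>L\<^esub> \<top>\<^bsub>K\<^esub> = \<top>\<^bsub>P\<^esub>"
proof
  have 0: "tens \<top>\<^bsub>L\<^esub> \<top>\<^bsub>K\<^esub> \<in> C_ideals L K" by (intro rect_closed) auto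
  then show "tens \<top>\<^bsub>L\<^esub> \<top>\<^bsub>K\<^esub> \<subseteq> \<top>\<^bsub>P\<^esub>" using C_ideal_sub by (simp add: top_P)
  show "\<top>\<^bsub>P\<^esub> \<subseteq> tens \<top>\<^bsub>L\<^esub> \<top>\<^bsub>K\<^esub>"
    using C_ideal_down[OF 0 rect_mem] by (auto simp: top_P L.top_higher K.top_higher)
qed

lemma proj1_hom: "proj1_inv L K \<in> frame_hom L P"
  unfolding frame_hom_def
proof (intro CollectI conjI ballI allI impI)
  show "proj1_inv L K \<in> carrier L \<rightarrow> carrier P"
    by (auto simp: proj1_inv_def rect_closed)
  show "proj1_inv L K \<top>\<^bsub>L\<^esub> = \<top>\<^bsub>P\<^esub>" by (simp add: proj1_inv_def rect_top)
  have kk: "\<top>\<^bsub>K\<^esub> \<sqinter>\<^bsub>K\<^esub> \<top>\<^bsub>K\<^esub> = \<top>\<^bsub>K\<^esub>" by (auto intro!: K.meet_eqI)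
  show "proj1_inv L K (x \<sqinter>\<^bsub>L\<^esub> y) = proj1_inv L K x \<sqinter>\<^bsub>P\<^esub> proj1_inv L K y"
    if "x \<in> carrier L" "y \<in> carrier L" for x y
    using that by (simp add: proj1_inv_def meet_P rect_closed rect_Int kk)
  show "proj1_inv L K (\<Squnion>\<^bsub>L\<^esub>A) = \<Squnion>\<^bsub>P\<^esub>(proj1_inv L K ` A)" if A: "A \<subseteq> carrier L" for A
  proof (rule sym, rule P.Sup_eqI)
    show "proj1_inv L K ` A \<subseteq> carrier P" using A by (auto simp: proj1_inv_def rect_closed)
    show "proj1_inv L K (\<Squnion>\<^bsub>L\<^esub>A) \<in> carrier P" using A by (auto simp: proj1_inv_def rect_closed)
    show "D \<sqsubseteq>\<^bsub>P\<^esub> proj1_inv L K (\<Squnion>\<^bsub>L\<^esub>A)" if "D \<in> proj1_inv L K ` A" for D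
    proof -
      from that obtain a where "a \<in> A" "D = tens a \<top>\<^bsub>K\<^esub>" by (auto simp: proj1_inv_def)
      then show ?thesis using A rect_mono[of a "\<top>\<^bsub>K\<^esub>" "\<Squnion>\<^bsub>L\<^esub>A" "\<top>\<^bsub>K\<^esub>"] L.sup_upper[OF A, of a]
        by (auto simp: proj1_inv_def)
    qed
    fix Z assume Z: "Z \<in> carrier P" "\<And>D. D \<in> proj1_inv L K ` A \<Longrightarrow> D \<sqsubseteq>\<^bsub>P\<^esub> Z"
    have "(a, \<top>\<^bsub>K\<^esub>) \<in> Z" if "a \<in> A" for a
      using Z(2)[OF imageI[OF that]] rect_mem by (auto simp: proj1_inv_def)
    then show "proj1_inv L K (\<Squnion>\<^bsub>L\<^esub>A) \<sqsubseteq>\<^bsub>P\<^esub> Z"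
      using A Z(1) by (auto simp: proj1_inv_def rect_subset_iff intro!: C_ideal_Sup1)
  qed
qed

lemma proj2_hom: "proj2_inv L K \<in> frame_hom K P"
  unfolding frame_hom_def
proof (intro CollectI conjI ballI allI impI)
  show "proj2_inv L K \<in> carrier K \<rightarrow> carrier P"
    by (auto simp: proj2_inv_def rect_closed)
  show "proj2_inv L K \<top>\<^bsub>K\<^esub> = \<top>\<^bsub>P\<^esub>" by (simp add: proj2_inv_def rect_top)
  have ll: "\<top>\<^bsub>L\<^esub> \<sqinter>\<^bsub>L\<^esub> \<top>\<^bsub>L\<^esub> = \<top>\<^bsub>L\<^esub>" by (auto intro!: L.meet_eqI)
  show "proj2_inv L K (x \<sqinter>\<^bsub>K\<^esub> y) = proj2_inv L K x \<sqinter>\<^bsub>P\<^esub> proj2_inv L K y"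
    if "x \<in> carrier K" "y \<in> carrier K" for x y
    using that by (simp add: proj2_inv_def meet_P rect_closed rect_Int ll)
  show "proj2_inv L K (\<Squnion>\<^bsub>K\<^esub>B) = \<Squnion>\<^bsub>P\<^esub>(proj2_inv L K ` B)" if B: "B \<subseteq> carrier K" for B
  proof (rule sym, rule P.Sup_eqI)
    show "proj2_inv L K ` B \<subseteq> carrier P" using B by (auto simp: proj2_inv_def rect_closed)
    show "proj2_inv L K (\<Squnion>\<^bsub>K\<^esub>B) \<in> carrier P" using B by (auto simp: proj2_inv_def rect_closed)
    show "D \<sqsubseteq>\<^bsub>P\<^esub> proj2_inv L K (\<Squnion>\<^bsub>K\<^esub>B)" if "D \<in> proj2_inv L K ` B" for D
    proof -
      from that obtain b where "b \<in> B" "D = tens \<top>\<^bsub>L\<^esub> b" by (auto simp: proj2_inv_def)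
      then show ?thesis using B rect_mono[of "\<top>\<^bsub>L\<^esub>" b "\<top>\<^bsub>L\<^esub>" "\<Squnion>\<^bsub>K\<^esub>B"] K.sup_upper[OF B, of b]
        by (auto simp: proj2_inv_def)
    qed
    fix Z assume Z: "Z \<in> carrier P" "\<And>D. D \<in> proj2_inv L K ` B \<Longrightarrow> D \<sqsubseteq>\<^bsub>P\<^esub> Z"
    have "(\<top>\<^bsub>L\<^esub>, b) \<in> Z" if "b \<in> B" for b
      using Z(2)[OF imageI[OF that]] rect_mem by (auto simp: proj2_inv_def)
    then show "proj2_inv L K (\<Squnion>\<^bsub>K\<^esub>B) \<sqsubseteq>\<^bsub>P\<^esub> Z"
      using B Z(1) by (auto simp: proj2_inv_def rect_subset_iff intro!: C_ideal_Sup2)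
  qed
qed

lemma pairing_eq:
  assumes X: "frame X" and h: "is_pairing X L K f g h" and D: "D \<in> C_ideals L K"
  shows "h D = \<Squnion>\<^bsub>X\<^esub>((\<lambda>(a, b). f a \<sqinter>\<^bsub>X\<^esub> g b) ` D)"
proof -
  have hom: "h \<in> frame_hom P X" using h by (auto simp: is_pairing_def locale_map_def)
  have sub: "(\<lambda>(a, b). tens a b) ` D \<subseteq> carrier P"
    using C_ideal_sub[OF D] by (auto intro!: rect_closed)
  have c: "a \<in> carrier L" "b \<in> carrier K" if "(a, b) \<in> D" for a b
    using C_ideal_sub[OF D] that by auto
  have p: "proj1_inv L K a \<in> carrier P" "proj2_inv L K b \<in> carrier P"
    if "a \<in> carrier L" "b \<in> carrier K" for a b
    using that by (auto simp: proj1_inv_def proj2_inv_def rect_closed)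
  have "h (tens a b) = f a \<sqinter>\<^bsub>X\<^esub> g b" if "(a, b) \<in> D" for a b
    using c[OF that] hom h p[OF c[OF that]]
    by (simp add: rect_eq_meet frame_hom_def is_pairing_def)
  then have eq: "h ` (\<lambda>(a, b). tens a b) ` D = (\<lambda>(a, b). f a \<sqinter>\<^bsub>X\<^esub> g b) ` D"
    unfolding image_image by (intro image_cong) auto
  have "h D = h (\<Squnion>\<^bsub>P\<^esub>((\<lambda>(a, b). tens a b) ` D))"
    using C_ideal_eq_Sup[OF D] by simp
  also have "\<dots> = \<Squnion>\<^bsub>X\<^esub>(h ` (\<lambda>(a, b). tens a b) ` D)"
    using hom sub by (simp add: frame_hom_def)
  finally show ?thesis unfolding eq .
qed

lemma pairing_exists:
  fixes X :: "'c gorder"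
  assumes "frame X" and f: "f \<in> frame_hom L X" and g: "g \<in> frame_hom K X"
  shows "\<exists>h. is_pairing X L K f g h"
proof -
  interpret X: frame X by fact
  have fc [simp]: "f a \<in> carrier X" if "a \<in> carrier L" for a using f that by (auto simp: frame_hom_def)
  have gc [simp]: "g b \<in> carrier X" if "b \<in> carrier K" for b using g that by (auto simp: frame_hom_def)
  have fm: "f (a \<sqinter>\<^bsub>L\<^esub> b) = f a \<sqinter>\<^bsub>X\<^esub> f b" if "a \<in> carrier L" "b \<in> carrier L" for a b
    using f that by (auto simp: frame_hom_def)
  have gm: "g (a \<sqinter>\<^bsub>K\<^esub> b) = g a \<sqinter>\<^bsub>X\<^esub> g b" if "a \<in> carrier K" "b \<in> carrier K" for a b
    using g that by (auto simp: frame_hom_def)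
  have fS: "f (\<Squnion>\<^bsub>L\<^esub>A) = \<Squnion>\<^bsub>X\<^esub>(f ` A)" if "A \<subseteq> carrier L" for A
    using f that by (auto simp: frame_hom_def)
  have gS: "g (\<Squnion>\<^bsub>K\<^esub>B) = \<Squnion>\<^bsub>X\<^esub>(g ` B)" if "B \<subseteq> carrier K" for B
    using g that by (auto simp: frame_hom_def)
  have ft: "f \<top>\<^bsub>L\<^esub> = \<top>\<^bsub>X\<^esub>" and gt: "g \<top>\<^bsub>K\<^esub> = \<top>\<^bsub>X\<^esub>"
    using f g by (auto simp: frame_hom_def)
  have fmono: "f a \<sqsubseteq>\<^bsub>X\<^esub> f b" if "a \<in> carrier L" "b \<in> carrier L" "a \<sqsubseteq>\<^bsub>L\<^esub> b" for a b
    using fm[of a b] that L.le_iff_join[of a b] X.meet_right[of "f a" "f b"] by simp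
  have gmono: "g a \<sqsubseteq>\<^bsub>X\<^esub> g b" if "a \<in> carrier K" "b \<in> carrier K" "a \<sqsubseteq>\<^bsub>K\<^esub> b" for a b
    using gm[of a b] that K.le_iff_join[of a b] X.meet_right[of "g a" "g b"] by simp
  define \<phi> where "\<phi> = (\<lambda>(a, b). f a \<sqinter>\<^bsub>X\<^esub> g b)"
  have \<phi>c: "\<phi> p \<in> carrier X" if "p \<in> carrier L \<times> carrier K" for p
    using that by (auto simp: \<phi>_def)
  define h where "h = restrict (\<lambda>D. \<Squnion>\<^bsub>X\<^esub>(\<phi> ` D)) (C_ideals L K)"
  have h: "h D = \<Squnion>\<^bsub>X\<^esub>(\<phi> ` D)" if "D \<in> C_ideals L K" for D
    using that by (simp add: h_def)
  have \<phi>s: "\<phi> ` D \<subseteq> carrier X" if "D \<in> C_ideals L K" for D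
    using C_ideal_sub[OF that] \<phi>c by auto
  have hc: "h D \<in> carrier X" if "D \<in> C_ideals L K" for D
    using that \<phi>s by (simp add: h)
  have hu: "\<phi> p \<sqsubseteq>\<^bsub>X\<^esub> h D" if "D \<in> C_ideals L K" "p \<in> D" for p D
    using that \<phi>s[of D] X.sup_upper[of "\<phi> ` D" "\<phi> p"] by (simp add: h)
  have hl: "h D \<sqsubseteq>\<^bsub>X\<^esub> z" if "D \<in> C_ideals L K" "z \<in> carrier X" "\<And>p. p \<in> D \<Longrightarrow> \<phi> p \<sqsubseteq>\<^bsub>X\<^esub> z" for D z
    using that \<phi>s[of D] by (auto simp: h intro!: X.sup_least)
  text \<open>The right adjoint of the map.\<close>
  define R where "R = (\<lambda>z. {p \<in> carrier L \<times> carrier K. \<phi> p \<sqsubseteq>\<^bsub>X\<^esub> z})"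
  have R: "R z \<in> C_ideals L K" if z: "z \<in> carrier X" for z
  proof (rule C_idealI)
    fix x y x' y'
    assume a: "(x, y) \<in> R z" "x' \<in> carrier L" "y' \<in> carrier K" "x' \<sqsubseteq>\<^bsub>L\<^esub> x" "y' \<sqsubseteq>\<^bsub>K\<^esub> y"
    have c: "x \<in> carrier L" "y \<in> carrier K" "\<phi> (x, y) \<sqsubseteq>\<^bsub>X\<^esub> z" using a by (auto simp: R_def)
    have "\<phi> (x', y') \<sqsubseteq>\<^bsub>X\<^esub> \<phi> (x, y)"
      using a c fmono[of x' x] gmono[of y' y] by (auto simp: \<phi>_def intro!: X.meet_mono)
    then have "\<phi> (x', y') \<sqsubseteq>\<^bsub>X\<^esub> z"
      using X.le_trans[OF _ c(3)] \<phi>c[of "(x, y)"] \<phi>c[of "(x', y')"] a c z by auto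
    then show "(x', y') \<in> R z" using a by (auto simp: R_def)
  next
    fix A y
    assume a: "A \<subseteq> carrier L" "y \<in> carrier K" "\<And>a. a \<in> A \<Longrightarrow> (a, y) \<in> R z"
    have "f ` A \<subseteq> carrier X" using a by auto
    then have "\<phi> (\<Squnion>\<^bsub>L\<^esub>A, y) = \<Squnion>\<^bsub>X\<^esub>((\<lambda>u. u \<sqinter>\<^bsub>X\<^esub> g y) ` f ` A)"
      using a X.Sup_meet[of "g y" "f ` A"] by (simp add: \<phi>_def fS)
    also have "\<dots> \<sqsubseteq>\<^bsub>X\<^esub> z"
      using a z by (intro X.sup_least) (auto simp: R_def \<phi>_def)
    finally show "(\<Squnion>\<^bsub>L\<^esub>A, y) \<in> R z" using a by (auto simp: R_def)
  next
    fix x B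
    assume a: "x \<in> carrier L" "B \<subseteq> carrier K" "\<And>b. b \<in> B \<Longrightarrow> (x, b) \<in> R z"
    have "g ` B \<subseteq> carrier X" using a by auto
    then have "\<phi> (x, \<Squnion>\<^bsub>K\<^esub>B) = \<Squnion>\<^bsub>X\<^esub>((\<lambda>u. f x \<sqinter>\<^bsub>X\<^esub> u) ` g ` B)"
      using a X.meet_Sup[of "f x" "g ` B"] by (simp add: \<phi>_def gS)
    also have "\<dots> \<sqsubseteq>\<^bsub>X\<^esub> z"
      using a z by (intro X.sup_least) (auto simp: R_def \<phi>_def)
    finally show "(x, \<Squnion>\<^bsub>K\<^esub>B) \<in> R z" using a by (auto simp: R_def)
  qed (auto simp: R_def)
  have hR: "h D \<sqsubseteq>\<^bsub>X\<^esub> z \<longleftrightarrow> D \<subseteq> R z" if D: "D \<in> C_ideals L K" and z: "z \<in> carrier X" for D z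
  proof
    assume l: "h D \<sqsubseteq>\<^bsub>X\<^esub> z"
    show "D \<subseteq> R z"
    proof
      fix p assume p: "p \<in> D"
      then have pc: "p \<in> carrier L \<times> carrier K" using C_ideal_sub[OF D] by auto
      have "\<phi> p \<sqsubseteq>\<^bsub>X\<^esub> z" by (rule X.le_trans[OF hu[OF D p] l \<phi>c[OF pc] hc[OF D] z])
      with pc show "p \<in> R z" by (simp add: R_def)
    qed
  next
    assume "D \<subseteq> R z"
    then show "h D \<sqsubseteq>\<^bsub>X\<^esub> z" by (intro hl[OF D z]) (auto simp: R_def)
  qed
  have h_rect: "h (tens a b) = \<phi> (a, b)" if "a \<in> carrier L" "b \<in> carrier K" for a b
  proof (rule X.le_antisym)
    have "(a, b) \<in> R (\<phi> (a, b))" using that \<phi>c[of "(a, b)"] by (auto simp: R_def)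
    then show "h (tens a b) \<sqsubseteq>\<^bsub>X\<^esub> \<phi> (a, b)"
      using that \<phi>c[of "(a, b)"] R by (subst hR) (auto simp: rect_closed dest: rect_least[rotated])
    show "\<phi> (a, b) \<sqsubseteq>\<^bsub>X\<^esub> h (tens a b)"
      using that rect_mem by (intro hu rect_closed)
  qed (use that \<phi>c hc rect_closed in auto)
  have hom: "h \<in> frame_hom P X"
    unfolding frame_hom_def
  proof (intro CollectI conjI ballI allI impI)
    show "h \<in> carrier P \<rightarrow> carrier X" using hc by auto
    have "h \<top>\<^bsub>P\<^esub> = \<top>\<^bsub>X\<^esub> \<sqinter>\<^bsub>X\<^esub> \<top>\<^bsub>X\<^esub>"
      unfolding rect_top[symmetric] by (simp add: h_rect) (simp add: \<phi>_def ft gt)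
    then show "h \<top>\<^bsub>P\<^esub> = \<top>\<^bsub>X\<^esub>" using X.meet_eqI[of "\<top>\<^bsub>X\<^esub>" "\<top>\<^bsub>X\<^esub>" "\<top>\<^bsub>X\<^esub>"] by simp
  next
    fix \<D> assume \<D>: "\<D> \<subseteq> carrier P"
    have S: "\<Squnion>\<^bsub>P\<^esub>\<D> \<in> C_ideals L K" using P.sup_closed[OF \<D>] by simp
    show "h (\<Squnion>\<^bsub>P\<^esub>\<D>) = \<Squnion>\<^bsub>X\<^esub>(h ` \<D>)"
    proof (rule sym, rule X.Sup_eqI)
      show "h ` \<D> \<subseteq> carrier X" "h (\<Squnion>\<^bsub>P\<^esub>\<D>) \<in> carrier X" using hc \<D> S by auto
    next
      fix u assume "u \<in> h ` \<D>"
      then obtain D where D: "D \<in> \<D>" "u = h D" by auto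
      then have "D \<subseteq> \<Squnion>\<^bsub>P\<^esub>\<D>" using P.sup_upper[OF \<D>, of D] by simp
      moreover have "D \<in> C_ideals L K" using D \<D> by auto
      ultimately show "u \<sqsubseteq>\<^bsub>X\<^esub> h (\<Squnion>\<^bsub>P\<^esub>\<D>)"
        unfolding D(2) using hu[OF S] hc[OF S] by (intro hl) auto
    next
      fix z assume z: "z \<in> carrier X" "\<And>a. a \<in> h ` \<D> \<Longrightarrow> a \<sqsubseteq>\<^bsub>X\<^esub> z"
      have "D \<subseteq> R z" if "D \<in> \<D>" for D
        using hR[of D z] z that \<D> by auto
      then have "\<Squnion>\<^bsub>P\<^esub>\<D> \<subseteq> R z"
        using P.sup_least[OF \<D>, of "R z"] R[OF z(1)] by auto
      then show "h (\<Squnion>\<^bsub>P\<^esub>\<D>) \<sqsubseteq>\<^bsub>X\<^esub> z" using hR[OF S z(1)] by simp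
    qed
  next
    fix D E assume "D \<in> carrier P" "E \<in> carrier P"
    then have DE: "D \<in> C_ideals L K" "E \<in> C_ideals L K" by auto
    have I: "D \<inter> E \<in> C_ideals L K" by (rule C_ideal_Int[OF DE])
    have "h D \<sqinter>\<^bsub>X\<^esub> h E = h (D \<inter> E)"
    proof (rule X.le_antisym)
      have pq: "\<phi> p \<sqinter>\<^bsub>X\<^esub> \<phi> q \<sqsubseteq>\<^bsub>X\<^esub> h (D \<inter> E)" if p: "p \<in> D" and q: "q \<in> E" for p q
      proof -
        obtain a b where pe: "p = (a, b)" by (cases p)
        obtain a' b' where qe: "q = (a', b')" by (cases q)
        have c: "a \<in> carrier L" "b \<in> carrier K" "a' \<in> carrier L" "b' \<in> carrier K"
          using p q C_ideal_sub[OF DE(1)] C_ideal_sub[OF DE(2)] by (auto simp: pe qe)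
        have "(a \<sqinter>\<^bsub>L\<^esub> a', b \<sqinter>\<^bsub>K\<^esub> b') \<in> D"
          by (rule C_ideal_down[OF DE(1), of a b]) (use p c in \<open>auto simp: pe intro: L.meet_left K.meet_left\<close>)
        moreover have "(a \<sqinter>\<^bsub>L\<^esub> a', b \<sqinter>\<^bsub>K\<^esub> b') \<in> E"
          by (rule C_ideal_down[OF DE(2), of a' b']) (use q c in \<open>auto simp: qe intro: L.meet_right K.meet_right\<close>)
        ultimately have 1: "\<phi> (a \<sqinter>\<^bsub>L\<^esub> a', b \<sqinter>\<^bsub>K\<^esub> b') \<sqsubseteq>\<^bsub>X\<^esub> h (D \<inter> E)"
          by (intro hu[OF I]) auto
        have 2: "\<phi> p \<sqinter>\<^bsub>X\<^esub> \<phi> q \<sqsubseteq>\<^bsub>X\<^esub> (f a \<sqinter>\<^bsub>X\<^esub> f a') \<sqinter>\<^bsub>X\<^esub> (g b \<sqinter>\<^bsub>X\<^esub> g b')"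
        proof -
          have m: "\<phi> p \<sqinter>\<^bsub>X\<^esub> \<phi> q \<sqsubseteq>\<^bsub>X\<^esub> f a \<sqinter>\<^bsub>X\<^esub> g b" "\<phi> p \<sqinter>\<^bsub>X\<^esub> \<phi> q \<sqsubseteq>\<^bsub>X\<^esub> f a' \<sqinter>\<^bsub>X\<^esub> g b'"
            using c X.meet_left[of "\<phi> p" "\<phi> q"] X.meet_right[of "\<phi> p" "\<phi> q"]
            by (simp_all add: pe qe \<phi>_def)
          have mc: "\<phi> p \<sqinter>\<^bsub>X\<^esub> \<phi> q \<in> carrier X" using c by (simp add: pe qe \<phi>_def)
          show ?thesis
            using c mc X.le_trans[OF m(1) X.meet_left] X.le_trans[OF m(1) X.meet_right]
              X.le_trans[OF m(2) X.meet_left] X.le_trans[OF m(2) X.meet_right]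
            by (intro X.meet_le) simp_all
        qed
        show ?thesis
          using X.le_trans[OF 2] 1 c hc[OF I] by (auto simp: \<phi>_def fm gm pe qe)
      qed
      have sc: "\<phi> ` E \<subseteq> carrier X" "\<phi> ` D \<subseteq> carrier X" using \<phi>s DE by auto
      have hE: "\<phi> p \<sqinter>\<^bsub>X\<^esub> h E \<sqsubseteq>\<^bsub>X\<^esub> h (D \<inter> E)" if p: "p \<in> D" for p
      proof -
        have pc: "\<phi> p \<in> carrier X" using p sc by auto
        show ?thesis
          unfolding h[OF DE(2)] X.meet_Sup[OF pc sc(1)]
        proof (rule X.sup_least)
          show "(\<lambda>a. \<phi> p \<sqinter>\<^bsub>X\<^esub> a) ` \<phi> ` E \<subseteq> carrier X"
            using pc sc by (auto simp: image_subset_iff)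
          fix u assume "u \<in> (\<lambda>a. \<phi> p \<sqinter>\<^bsub>X\<^esub> a) ` \<phi> ` E"
          then obtain q where "q \<in> E" "u = \<phi> p \<sqinter>\<^bsub>X\<^esub> \<phi> q" by (elim imageE) simp
          then show "u \<sqsubseteq>\<^bsub>X\<^esub> h (D \<inter> E)" using pq[OF p] by simp
        qed (rule hc[OF I])
      qed
      show "h D \<sqinter>\<^bsub>X\<^esub> h E \<sqsubseteq>\<^bsub>X\<^esub> h (D \<inter> E)"
        unfolding h[OF DE(1)] X.Sup_meet[OF hc[OF DE(2)] sc(2)]
      proof (rule X.sup_least)
        show "(\<lambda>a. a \<sqinter>\<^bsub>X\<^esub> h E) ` \<phi> ` D \<subseteq> carrier X"
          using hc[OF DE(2)] sc by (auto simp: image_subset_iff)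
        fix u assume "u \<in> (\<lambda>a. a \<sqinter>\<^bsub>X\<^esub> h E) ` \<phi> ` D"
        then obtain p where "p \<in> D" "u = \<phi> p \<sqinter>\<^bsub>X\<^esub> h E" by (elim imageE) simp
        then show "u \<sqsubseteq>\<^bsub>X\<^esub> h (D \<inter> E)" using hE by simp
      qed (rule hc[OF I])
      show "h (D \<inter> E) \<sqsubseteq>\<^bsub>X\<^esub> h D \<sqinter>\<^bsub>X\<^esub> h E"
        using hc DE I hu by (intro X.meet_le hl) auto
    qed (use hc I DE in auto)
    then show "h (D \<sqinter>\<^bsub>P\<^esub> E) = h D \<sqinter>\<^bsub>X\<^esub> h E"
      using DE by (simp add: meet_P)
  qed
  have "u \<sqinter>\<^bsub>X\<^esub> \<top>\<^bsub>X\<^esub> = u" "\<top>\<^bsub>X\<^esub> \<sqinter>\<^bsub>X\<^esub> u = u" if "u \<in> carrier X" for u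
    using that by (auto intro!: X.meet_eqI X.top_higher)
  then have "is_pairing X L K f g h"
    using hom frame_P \<open>frame X\<close>
    by (simp add: is_pairing_def locale_map_def proj1_inv_def proj2_inv_def h_rect)
      (simp add: \<phi>_def ft gt h_def)
  then show ?thesis by blast
qed

lemma pairing_unique:
  assumes "frame X" "is_pairing X L K f g h" "is_pairing X L K f g h'"
  shows "h = h'"
proof
  fix D show "h D = h' D"
  proof (cases "D \<in> C_ideals L K")
    case True
    then show ?thesis using pairing_eq assms by metis
  next
    case False
    then show ?thesis using assms(2,3) by (simp add: is_pairing_def extensional_def)
  qed
qed

end

theorem locale_prod_universal:
  fixes L :: "'a gorder" and K :: "'b gorder"
  assumes "frame L" "frame K"
  shows "locale_map (locale_prod L K) L (proj1_inv L K)"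
    and "locale_map (locale_prod L K) K (proj2_inv L K)"
    and "\<And>X f g. locale_map X L f \<Longrightarrow> locale_map X K g \<Longrightarrow> \<exists>!h. is_pairing X L K f g h"
proof -
  interpret frame_pair L K using assms by (simp add: frame_pair_def)
  show "locale_map (locale_prod L K) L (proj1_inv L K)"
    "locale_map (locale_prod L K) K (proj2_inv L K)"
    using assms frame_P proj1_hom proj2_hom by (auto simp: locale_map_def)
  show "\<exists>!h. is_pairing X L K f g h" if "locale_map X L f" "locale_map X K g" for X f g
    using that pairing_exists pairing_unique unfolding locale_map_def by metis
qed

corollary is_pairing_locale_pairing:
  assumes "locale_map X L f" "locale_map X K g"
  shows "is_pairing X L K f g (locale_pairing X L K f g)"
  unfolding locale_pairing_def
proof (rule theI'[of "is_pairing X L K f g"])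
  have "frame L" "frame K" using assms by (simp_all add: locale_map_def)
  from locale_prod_universal(3)[OF this assms] show "\<exists>!h. is_pairing X L K f g h" .
qed

corollary locale_pairing_eq:
  assumes "locale_map X L f" "locale_map X K g" "D \<in> carrier (locale_prod L K)"
  shows "locale_pairing X L K f g D = \<Squnion>\<^bsub>X\<^esub>((\<lambda>(a, b). f a \<sqinter>\<^bsub>X\<^esub> g b) ` D)"
proof -
  interpret frame_pair L K using assms by (simp add: frame_pair_def locale_map_def)
  have "frame X" using assms by (simp add: locale_map_def)
  then show ?thesis
    using pairing_eq is_pairing_locale_pairing[OF assms(1,2)] assms(3) by simp
qed

section \<open>The locales of futures and pasts\<close>

definition opens_locale :: "('m::topological_space) set gorder" where
  "opens_locale = inclusion_order {U. open U}"

text \<open>The preorder is only used between open sets.\<close>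

definition open_le ::
    "('m::topological_space, 'e::euclidean_space) spacetime \<Rightarrow> 'm set \<Rightarrow> 'm set \<Rightarrow> bool" where
  "open_le M U V \<longleftrightarrow> U \<subseteq> J_minus M V \<and> V \<subseteq> J_plus M U"

definition up_cone ::
    "('m::topological_space, 'e::euclidean_space) spacetime \<Rightarrow> 'm set \<Rightarrow> 'm set" where
  "up_cone M U = \<Union>{V. open V \<and> open_le M U V}"

definition down_cone ::
    "('m::topological_space, 'e::euclidean_space) spacetime \<Rightarrow> 'm set \<Rightarrow> 'm set" where
  "down_cone M U = \<Union>{W. open W \<and> open_le M W U}"

definition locale_of_futures ::
    "('m::topological_space, 'e::euclidean_space) spacetime \<Rightarrow> 'm set gorder" where
  "locale_of_futures M = inclusion_order (up_cone M ` {U. open U})"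

definition locale_of_pasts ::
    "('m::topological_space, 'e::euclidean_space) spacetime \<Rightarrow> 'm set gorder" where
  "locale_of_pasts M = inclusion_order (down_cone M ` {U. open U})"

text \<open>The maps from \<open>M\<close> to the locales of futures and pasts have as inverse image maps the subframe
  inclusions, that is, \<open>\<lambda>U. U\<close>.\<close>

definition canonical_map ::
    "('m::topological_space, 'e::euclidean_space) spacetime \<Rightarrow> ('m set \<times> 'm set) set \<Rightarrow> 'm set" where
  "canonical_map M =
     locale_pairing opens_locale (locale_of_futures M) (locale_of_pasts M) (\<lambda>U. U) (\<lambda>U. U)"

end

theory Submission
  imports Defs
begin

text \<open>
  The futures and pasts of open sets are open, so the frames of the locales of futures and pasts are
  the topologies of open up-sets and of open down-sets. The canonical map sends a C-ideal to the union
  of the intersections \<open>a \<inter> b\<close> over its members \<open>(a, b)\<close>; hence it is surjective iff these intersections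
  form a basis of the topology of \<open>M\<close>. They are causally convex, and a causally convex open set \<open>U\<close>
  equals \<open>J\<^sup>+(U) \<inter> J\<^sup>-(U)\<close>.

  Openness is shown without the push-up lemma and without normal neighbourhoods: near each of its
  points, a causal curve can be tilted into the future cone by a small timelike vector, and then be
  translated so as to end (or to start) at any prescribed nearby point, while its other end moves only
  a little. A subdivision of the curve reduces the global claim to this local one.
\<close>

section \<open>Frames of open sets\<close>

lemma inclusion_order_simps [simp]:
  "carrier (inclusion_order S) = S" "x \<sqsubseteq>\<^bsub>inclusion_order S\<^esub> y \<longleftrightarrow> x \<subseteq> y"
  by (simp_all add: inclusion_order_def)

text \<open>\<open>istopology\<close> supplies binary intersections and arbitrary unions, hence also
  the empty set; membership of \<open>UNIV\<close> makes the whole space the top element. Joins and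
  finite meets are then the set-theoretic ones.\<close>

locale topology_frame =
  fixes S :: "'a set set"
  assumes istopology: "istopology (\<lambda>U. U \<in> S)" and UNIV_mem: "UNIV \<in> S"
begin

lemma Union_mem: "A \<subseteq> S \<Longrightarrow> \<Union>A \<in> S"
  using istopology unfolding istopology_def by blast

lemma Int_mem: "a \<in> S \<Longrightarrow> b \<in> S \<Longrightarrow> a \<inter> b \<in> S"
  using istopology unfolding istopology_def by blast

sublocale complete_lattice "inclusion_order S"
proof -
  interpret partial_order "inclusion_order S" by (rule partial_order_inclusion_order)
  show "complete_lattice (inclusion_order S)"
  proof
    fix A assume A: "A \<subseteq> carrier (inclusion_order S)"
    show "\<exists>s. least (inclusion_order S) s (Upper (inclusion_order S) A)"
      using A Union_mem[of A] by (intro exI[of _ "\<Union>A"]) (auto simp: least_def Upper_def)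
    \<comment> \<open>The intersection of an infinite family may leave \<open>S\<close>, so the
      infimum is the union of all members of \<open>S\<close> below the family.\<close>
    have "\<Union>{z \<in> S. \<forall>a\<in>A. z \<subseteq> a} \<in> S" by (rule Union_mem) auto
    then show "\<exists>s. greatest (inclusion_order S) s (Lower (inclusion_order S) A)"
      using A by (intro exI[of _ "\<Union>{z \<in> S. \<forall>a\<in>A. z \<subseteq> a}"]) (auto simp: greatest_def Lower_def)
  qed
qed

lemma Sup_eq: "A \<subseteq> S \<Longrightarrow> \<Squnion>\<^bsub>inclusion_order S\<^esub>A = \<Union>A"
  by (rule Sup_eqI) (auto intro: Union_mem)

lemma meet_eq: "a \<in> S \<Longrightarrow> b \<in> S \<Longrightarrow> a \<sqinter>\<^bsub>inclusion_order S\<^esub> b = a \<inter> b"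
  by (rule meet_eqI) (auto intro: Int_mem)

lemma top_eq: "\<top>\<^bsub>inclusion_order S\<^esub> = UNIV"
  using top_higher[of UNIV] UNIV_mem by auto

lemma frame: "frame (inclusion_order S)"
proof
  fix x A assume x: "x \<in> carrier (inclusion_order S)" and A: "A \<subseteq> carrier (inclusion_order S)"
  have "(\<lambda>a. x \<sqinter>\<^bsub>inclusion_order S\<^esub> a) ` A = (\<lambda>a. x \<inter> a) ` A"
    using x A by (intro image_cong) (auto simp: meet_eq)
  moreover have "(\<lambda>a. x \<inter> a) ` A \<subseteq> S" using x A by (auto intro: Int_mem)
  ultimately show "x \<sqinter>\<^bsub>inclusion_order S\<^esub> \<Squnion>\<^bsub>inclusion_order S\<^esub>A =
      \<Squnion>\<^bsub>inclusion_order S\<^esub>((\<lambda>a. x \<sqinter>\<^bsub>inclusion_order S\<^esub> a) ` A)"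
    using x A Union_mem[of A] by (simp add: Sup_eq meet_eq)
qed

end

section \<open>Maps to coarser topologies and their pairing\<close>

lemma locale_map_coarser_topology:
  assumes "topology_frame T" "topology_frame F" "F \<subseteq> T"
  shows "locale_map (inclusion_order T) (inclusion_order F) (\<lambda>U. U)"
proof -
  interpret T: topology_frame T by fact
  interpret F: topology_frame F by fact
  have "(\<lambda>U. U) \<in> frame_hom (inclusion_order F) (inclusion_order T)"
    unfolding frame_hom_def
  proof (intro CollectI conjI ballI allI impI)
    fix A assume "A \<subseteq> carrier (inclusion_order F)"
    then show "\<Squnion>\<^bsub>inclusion_order F\<^esub>A = \<Squnion>\<^bsub>inclusion_order T\<^esub>((\<lambda>U. U) ` A)"
      using assms(3) by (simp add: F.Sup_eq T.Sup_eq subset_trans)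
  next
    fix x y assume "x \<in> carrier (inclusion_order F)" "y \<in> carrier (inclusion_order F)"
    then show "x \<sqinter>\<^bsub>inclusion_order F\<^esub> y = x \<sqinter>\<^bsub>inclusion_order T\<^esub> y"
      using assms(3) by (simp add: F.meet_eq T.meet_eq subset_iff)
  qed (use assms(3) in \<open>auto simp: F.top_eq T.top_eq\<close>)
  then show ?thesis using T.frame F.frame by (simp add: locale_map_def)
qed

text \<open>The universal property of the product already makes the pairing a map of locales, so
  only surjectivity is at stake. Its values are unions of sets \<open>a \<inter> b\<close>, and
  every \<open>W\<close> is such a union iff these sets form a basis of \<open>T\<close>.\<close>

lemma defines_sublocale_pairing_iff:
  assumes T: "topology_frame T" and F: "topology_frame F" "F \<subseteq> T" and P: "topology_frame P" "P \<subseteq> T"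
  shows "defines_sublocale (inclusion_order T) (locale_prod (inclusion_order F) (inclusion_order P))
      (locale_pairing (inclusion_order T) (inclusion_order F) (inclusion_order P) (\<lambda>U. U) (\<lambda>U. U)) \<longleftrightarrow>
    (\<forall>W\<in>T. \<forall>x\<in>W. \<exists>a\<in>F. \<exists>b\<in>P. x \<in> a \<inter> b \<and> a \<inter> b \<subseteq> W)"
proof -
  interpret T: topology_frame T by fact
  interpret F: topology_frame F by fact
  interpret P: topology_frame P by fact
  define L where "L = inclusion_order F"
  define K where "K = inclusion_order P"
  define h where "h = locale_pairing (inclusion_order T) L K (\<lambda>U. U) (\<lambda>U. U)"
  interpret LK: frame_pair L K
    using F.frame P.frame by (simp add: frame_pair_def L_def K_def)
  have maps: "locale_map (inclusion_order T) L (\<lambda>U. U)" "locale_map (inclusion_order T) K (\<lambda>U. U)"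
    unfolding L_def K_def by (rule locale_map_coarser_topology; fact)+
  have h_map: "locale_map (inclusion_order T) (locale_prod L K) h"
    using is_pairing_locale_pairing[OF maps] by (simp add: is_pairing_def h_def)
  have h_eq: "h D = (\<Union>(a, b)\<in>D. a \<inter> b)" if "D \<in> C_ideals L K" for D
  proof -
    have D: "D \<subseteq> F \<times> P" using LK.C_ideal_sub[OF that] by (simp add: L_def K_def)
    have "(\<lambda>(a, b). a \<sqinter>\<^bsub>inclusion_order T\<^esub> b) ` D = (\<lambda>(a, b). a \<inter> b) ` D"
      using D assms by (intro image_cong) (auto simp: T.meet_eq subset_iff)
    moreover have "(\<lambda>(a, b). a \<inter> b) ` D \<subseteq> T"
      using D assms by (auto intro!: T.Int_mem)
    ultimately show ?thesis
      using locale_pairing_eq[OF maps, of D] that by (simp add: h_def T.Sup_eq)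
  qed
  have "h ` C_ideals L K = T \<longleftrightarrow> (\<forall>W\<in>T. \<forall>x\<in>W. \<exists>a\<in>F. \<exists>b\<in>P. x \<in> a \<inter> b \<and> a \<inter> b \<subseteq> W)"
  proof
    assume im: "h ` C_ideals L K = T"
    show "\<forall>W\<in>T. \<forall>x\<in>W. \<exists>a\<in>F. \<exists>b\<in>P. x \<in> a \<inter> b \<and> a \<inter> b \<subseteq> W"
    proof (intro ballI)
      fix W x assume "W \<in> T" "x \<in> W"
      then obtain D where D: "D \<in> C_ideals L K" "W = (\<Union>(a, b)\<in>D. a \<inter> b)"
        using im h_eq by (metis imageE)
      then obtain a b where ab: "(a, b) \<in> D" "x \<in> a \<inter> b" using \<open>x \<in> W\<close> by auto
      then show "\<exists>a\<in>F. \<exists>b\<in>P. x \<in> a \<inter> b \<and> a \<inter> b \<subseteq> W"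
        using LK.C_ideal_sub[OF D(1)] D(2) by (auto simp: L_def K_def)
    qed
  next
    assume base: "\<forall>W\<in>T. \<forall>x\<in>W. \<exists>a\<in>F. \<exists>b\<in>P. x \<in> a \<inter> b \<and> a \<inter> b \<subseteq> W"
    have "W \<in> h ` C_ideals L K" if "W \<in> T" for W
    proof -
      \<comment> \<open>The largest C-ideal with image inside \<open>W\<close>, that is, the value
        of the right adjoint of \<open>h\<close> at \<open>W\<close>. It is closed under suprema
        because intersection distributes over unions in either component; the basis property makes
        its image all of \<open>W\<close>.\<close>
      define D where "D = {(a, b) \<in> F \<times> P. a \<inter> b \<subseteq> W}"
      have D: "D \<in> C_ideals L K"
        by (rule LK.C_idealI)
          (fastforce simp: D_def L_def K_def F.Sup_eq P.Sup_eq intro: F.Union_mem P.Union_mem)+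
      have "h D = W"
        unfolding h_eq[OF D] using base \<open>W \<in> T\<close> by (fastforce simp: D_def)
      with D show ?thesis by blast
    qed
    moreover have "h ` C_ideals L K \<subseteq> T"
      using h_map by (auto simp: locale_map_def frame_hom_def)
    ultimately show "h ` C_ideals L K = T" by blast
  qed
  then show ?thesis
    using h_map by (simp add: defines_sublocale_def h_def L_def K_def locale_prod_def)
qed

section \<open>Smooth fields of bilinear forms\<close>

lemma smooth_on_has_derivative:
  assumes "smooth_on S f" "x \<in> S"
  shows "(f has_derivative frechet_derivative f (at x)) (at x)"
proof -
  have "Ck_on 1 S f" using assms by (simp add: smooth_on_def)
  then show ?thesis using assms(2) by (simp add: frechet_derivative_works)
qed

lemma smooth_on_continuous_derivative:
  assumes "smooth_on S f"
  shows "continuous_on S (\<lambda>x. frechet_derivative f (at x) v)"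
proof -
  have "Ck_on 1 S f" using assms by (simp add: smooth_on_def)
  then show ?thesis by simp
qed

lemma smooth_on_continuous: "smooth_on S f \<Longrightarrow> continuous_on S f"
  unfolding smooth_on_def using Ck_on.simps(1) by blast

lemma linear_eq_sum_Basis:
  fixes f :: "'a::euclidean_space \<Rightarrow> 'b::real_normed_vector"
  assumes "linear f"
  shows "f v = (\<Sum>i\<in>Basis. (v \<bullet> i) *\<^sub>R f i)"
proof -
  have "f v = f (\<Sum>i\<in>Basis. (v \<bullet> i) *\<^sub>R i)" by (simp add: euclidean_representation)
  then show ?thesis using assms by (simp add: linear_sum linear_scale)
qed

text \<open>\<open>Ck_on\<close> gives continuity of the derivative only in each fixed direction.
  Expanding the direction in the finite basis, by linearity, lets point and direction vary
  together.\<close>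

lemma smooth_on_continuous_derivative_compose:
  fixes f :: "'a::euclidean_space \<Rightarrow> 'b::real_normed_vector"
  assumes "smooth_on S f" "continuous_on X x" "continuous_on X v" "x ` X \<subseteq> S"
  shows "continuous_on X (\<lambda>t. frechet_derivative f (at (x t)) (v t))"
proof -
  have "continuous_on X (\<lambda>t. \<Sum>i\<in>Basis. (v t \<bullet> i) *\<^sub>R frechet_derivative f (at (x t)) i)"
    by (intro continuous_intros assms continuous_on_compose2[OF smooth_on_continuous_derivative[OF assms(1)]])
  moreover have "linear (frechet_derivative f (at (x t)))" if "t \<in> X" for t
    using smooth_on_has_derivative[OF assms(1)] assms(4) that has_derivative_linear by blast
  ultimately show ?thesis
    by (subst continuous_on_cong[OF refl linear_eq_sum_Basis]) auto
qed

text \<open>This is the mean value inequality on a convex ball: the sum of the absolute partial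
  derivatives dominates the operator norm and is bounded on a compact closed ball inside
  \<open>S\<close>.\<close>

lemma smooth_on_locally_lipschitz:
  fixes f :: "'a::euclidean_space \<Rightarrow> real"
  assumes "smooth_on S f" "open S" "p \<in> S"
  obtains r L where "r > 0" "L \<ge> 0" "ball p r \<subseteq> S"
    "\<And>x y. x \<in> ball p r \<Longrightarrow> y \<in> ball p r \<Longrightarrow> \<bar>f x - f y\<bar> \<le> L * norm (x - y)"
proof -
  obtain r where r: "r > 0" "cball p r \<subseteq> S"
    using assms open_contains_cball by blast
  have "continuous_on (cball p r) (\<lambda>x. \<Sum>i\<in>Basis. \<bar>frechet_derivative f (at x) i\<bar>)"
    by (intro continuous_intros continuous_on_subset[OF smooth_on_continuous_derivative[OF assms(1)] r(2)])
  from compact_imp_bounded[OF compact_continuous_image[OF this]] obtain B where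
    B: "\<And>x. x \<in> cball p r \<Longrightarrow> (\<Sum>i\<in>Basis. \<bar>frechet_derivative f (at x) i\<bar>) \<le> B"
    unfolding bounded_iff using abs_le_D1 by (fastforce simp del: mem_cball)
  show thesis
  proof (rule that[of r "max 0 B"])
    show "ball p r \<subseteq> S" using r(2) by auto
    fix x y assume xy: "x \<in> ball p r" "y \<in> ball p r"
    have "norm (f x - f y) \<le> max 0 B * norm (x - y)"
    proof (rule differentiable_bound[OF convex_ball _ _ xy])
      fix u assume u: "u \<in> ball p r"
      then have "u \<in> S" using r(2) by auto
      note d = smooth_on_has_derivative[OF assms(1) this]
      then show "(f has_derivative frechet_derivative f (at u)) (at u within ball p r)"
        by (rule has_derivative_at_withinI)
      have "norm (frechet_derivative f (at u) v) \<le> max 0 B * norm v" for v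
      proof -
        have "norm (frechet_derivative f (at u) v) \<le> (\<Sum>i\<in>Basis. \<bar>v \<bullet> i\<bar> * \<bar>frechet_derivative f (at u) i\<bar>)"
          by (subst linear_eq_sum_Basis[OF has_derivative_linear[OF d]])
            (auto intro: order_trans[OF sum_abs] simp: abs_mult)
        also have "\<dots> \<le> (\<Sum>i\<in>Basis. norm v * \<bar>frechet_derivative f (at u) i\<bar>)"
          by (intro sum_mono mult_right_mono Basis_le_norm) auto
        also have "\<dots> = (\<Sum>i\<in>Basis. \<bar>frechet_derivative f (at u) i\<bar>) * norm v"
          by (simp add: sum_distrib_left mult.commute)
        also have "\<dots> \<le> max 0 B * norm v"
          using B[of u] u by (intro mult_right_mono) auto
        finally show ?thesis .
      qed
      then show "onorm (frechet_derivative f (at u)) \<le> max 0 B" by (intro onorm_le)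
    qed
    then show "\<bar>f x - f y\<bar> \<le> max 0 B * norm (x - y)" by simp
  qed (use r in auto)
qed

section \<open>Fields of bilinear forms on an open set\<close>

lemma bilinear_eq_sum_Basis:
  fixes G :: "'a::euclidean_space \<Rightarrow> 'a \<Rightarrow> real"
  assumes "bilinear G"
  shows "G v w = (\<Sum>i\<in>Basis. \<Sum>j\<in>Basis. (v \<bullet> i) * (w \<bullet> j) * G i j)"
proof -
  have "G v w = (\<Sum>i\<in>Basis. (v \<bullet> i) *\<^sub>R G i w)"
    using assms by (intro linear_eq_sum_Basis) (simp add: bilinear_def)
  moreover have "G i w = (\<Sum>j\<in>Basis. (w \<bullet> j) *\<^sub>R G i j)" for i
    using assms by (intro linear_eq_sum_Basis) (simp add: bilinear_def)
  ultimately show ?thesis by (simp add: sum_distrib_left mult.assoc)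
qed

text \<open>Joint continuity reduces to that of the finitely many coefficients
  \<open>G x i j\<close>, each of which depends on the point alone.\<close>

lemma continuous_on_bilinear_field:
  fixes G :: "'a::topological_space \<Rightarrow> 'e::euclidean_space \<Rightarrow> 'e \<Rightarrow> real"
  assumes "\<And>x. x \<in> S \<Longrightarrow> bilinear (G x)" "\<And>v w. continuous_on S (\<lambda>x. G x v w)"
    "continuous_on X f" "continuous_on X v" "continuous_on X w" "f ` X \<subseteq> S"
  shows "continuous_on X (\<lambda>t. G (f t) (v t) (w t))"
proof -
  have "continuous_on X (\<lambda>t. \<Sum>i\<in>Basis. \<Sum>j\<in>Basis. (v t \<bullet> i) * (w t \<bullet> j) * G (f t) i j)"
    by (intro continuous_intros assms continuous_on_compose2[OF assms(2)])
  then show ?thesis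
    by (subst continuous_on_cong[OF refl bilinear_eq_sum_Basis]) (use assms in auto)
qed

text \<open>The Lipschitz constants of the coefficients add up, and each component of
  \<open>v\<close> is at most \<open>norm v\<close>, whence the factor
  \<open>(norm v)\<^sup>2\<close>.\<close>

lemma bilinear_field_locally_lipschitz:
  fixes G :: "'e::euclidean_space \<Rightarrow> 'e \<Rightarrow> 'e \<Rightarrow> real"
  assumes S: "open S" "p \<in> S" and bil: "\<And>x. x \<in> S \<Longrightarrow> bilinear (G x)"
    and smooth: "\<And>v w. smooth_on S (\<lambda>x. G x v w)"
  obtains r L where "r > 0" "L \<ge> 0" "ball p r \<subseteq> S"
    "\<And>x y v. x \<in> ball p r \<Longrightarrow> y \<in> ball p r \<Longrightarrow> \<bar>G x v v - G y v v\<bar> \<le> L * norm (x - y) * (norm v)\<^sup>2"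
proof -
  have "\<exists>r L. r > 0 \<and> L \<ge> 0 \<and> ball p r \<subseteq> S \<and>
      (\<forall>x\<in>ball p r. \<forall>y\<in>ball p r. \<bar>G x i j - G y i j\<bar> \<le> L * norm (x - y))" for i j
    using smooth_on_locally_lipschitz[OF smooth S, of i j] by metis
  then obtain r L where rL: "\<And>i j. r i j > 0" "\<And>i j. L i j \<ge> 0" "\<And>i j. ball p (r i j) \<subseteq> S"
    "\<And>i j x y. x \<in> ball p (r i j) \<Longrightarrow> y \<in> ball p (r i j) \<Longrightarrow> \<bar>G x i j - G y i j\<bar> \<le> L i j * norm (x - y)"
    by metis
  \<comment> \<open>A common radius for all coefficients, positive because \<open>Basis\<close> is
    finite.\<close>
  define R where "R = Min (case_prod r ` (Basis \<times> Basis))"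
  have R: "R > 0" "\<And>i j. i \<in> Basis \<Longrightarrow> j \<in> Basis \<Longrightarrow> R \<le> r i j"
    unfolding R_def by (auto simp: rL intro!: Min_le)
  have RS: "ball p R \<subseteq> S"
    using R(2)[OF SOME_Basis SOME_Basis] rL(3) by (meson order_trans subset_ball)
  show thesis
  proof (rule that[OF R(1) _ RS])
    show "0 \<le> (\<Sum>i\<in>Basis. \<Sum>j\<in>Basis. L i j)" by (intro sum_nonneg rL)
    fix x y v assume xy: "x \<in> ball p R" "y \<in> ball p R"
    have "\<bar>G x v v - G y v v\<bar> = \<bar>\<Sum>i\<in>Basis. \<Sum>j\<in>Basis. (v \<bullet> i) * (v \<bullet> j) * (G x i j - G y i j)\<bar>"
      using xy RS by (simp add: bilinear_eq_sum_Basis[OF bil] subset_iff right_diff_distrib sum_subtractf)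
    also have "\<dots> \<le> (\<Sum>i\<in>Basis. \<Sum>j\<in>Basis. \<bar>(v \<bullet> i) * (v \<bullet> j) * (G x i j - G y i j)\<bar>)"
      by (intro order_trans[OF sum_abs] sum_mono sum_abs)
    also have "\<dots> \<le> (\<Sum>i\<in>Basis. \<Sum>j\<in>Basis. norm v * norm v * (L i j * norm (x - y)))"
      unfolding abs_mult
    proof (intro sum_mono mult_mono Basis_le_norm)
      fix i j :: 'e assume "i \<in> Basis" "j \<in> Basis"
      then show "\<bar>G x i j - G y i j\<bar> \<le> L i j * norm (x - y)"
        using xy R(2)[of i j] by (intro rL(4)) auto
    qed auto
    also have "\<dots> = (\<Sum>i\<in>Basis. \<Sum>j\<in>Basis. L i j) * norm (x - y) * (norm v)\<^sup>2"
      by (simp add: sum_distrib_left sum_distrib_right power2_eq_square mult_ac)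
    finally show "\<bar>G x v v - G y v v\<bar> \<le> (\<Sum>i\<in>Basis. \<Sum>j\<in>Basis. L i j) * norm (x - y) * (norm v)\<^sup>2" .
  qed
qed

lemma eventually_continuous_neg:
  fixes f :: "'a::t2_space \<Rightarrow> real"
  assumes "continuous_on S f" "open S" "p \<in> S" "f p < a"
  shows "\<forall>\<^sub>F x in nhds p. f x < a"
proof -
  have "isCont f p" by (rule continuous_on_interior[OF assms(1)]) (simp add: assms interior_open)
  then have "(f \<longlongrightarrow> f p) (nhds p)" unfolding isCont_def tendsto_at_iff_tendsto_nhds .
  then show ?thesis using assms(4) by (rule order_tendstoD)
qed

text \<open>Adding \<open>\<epsilon> T\<close> with \<open>T\<close> timelike to a causal vector lowers its square by a multiple of \<open>\<epsilon>\<close>, which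
  outweighs the change of the form under a displacement of the base point by a small multiple of \<open>\<epsilon>\<close>.\<close>

lemma causal_vector_perturbation:
  fixes G :: "'e::euclidean_space \<Rightarrow> 'e \<Rightarrow> 'e \<Rightarrow> real"
  assumes S: "open S" "p \<in> S" and bil: "\<And>x. x \<in> S \<Longrightarrow> bilinear (G x)"
    and sym: "\<And>x v w. x \<in> S \<Longrightarrow> G x v w = G x w v"
    and smooth: "\<And>v w. smooth_on S (\<lambda>x. G x v w)"
    and \<tau>: "continuous_on S \<tau>"
    and neg: "G p u (\<tau> p) < 0" "G p (\<tau> p) (\<tau> p) < 0"
  obtains r where "r > 0" "ball p r \<subseteq> S"
    "\<And>x y w \<epsilon>. x \<in> ball p r \<Longrightarrow> y \<in> ball p r \<Longrightarrow> w \<in> ball u r \<Longrightarrow> 0 < \<epsilon> \<Longrightarrow> \<epsilon> < r \<Longrightarrow>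
       norm (y - x) \<le> r * \<epsilon> \<Longrightarrow> G x w w \<le> 0 \<Longrightarrow>
       G y (w + \<epsilon> *\<^sub>R \<tau> p) (w + \<epsilon> *\<^sub>R \<tau> p) \<le> 0 \<and> G y (w + \<epsilon> *\<^sub>R \<tau> p) (\<tau> y) < 0"
proof -
  define T where "T = \<tau> p"
  obtain r1 L where r1: "r1 > 0" "L \<ge> 0" "ball p r1 \<subseteq> S"
    and L: "\<And>x y v. x \<in> ball p r1 \<Longrightarrow> y \<in> ball p r1 \<Longrightarrow> \<bar>G x v v - G y v v\<bar> \<le> L * norm (x - y) * (norm v)\<^sup>2"
    by (rule bilinear_field_locally_lipschitz[OF S bil smooth]; (assumption | (rule that; assumption)))
  have op: "open (S \<times> (UNIV :: 'e set))" using S by (intro open_Times) auto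
  have mem: "(p, u) \<in> S \<times> UNIV" using S by auto
  have contG: "continuous_on X (\<lambda>t. G (f t) (v t) (w t))"
    if "continuous_on X f" "continuous_on X v" "continuous_on X w" "f ` X \<subseteq> S"
    for X :: "('e \<times> 'e) set" and f v w
    by (rule continuous_on_bilinear_field[OF bil smooth_on_continuous[OF smooth]]) (use that in auto)
  have "\<forall>\<^sub>F z in nhds (p, u). G (fst z) (snd z) T < G p u T / 2"
    using neg by (intro eventually_continuous_neg[OF contG op mem] continuous_intros) (auto simp: T_def)
  moreover have "\<forall>\<^sub>F z in nhds (p, u). G (fst z) T T < 0"
    using neg by (intro eventually_continuous_neg[OF contG op mem] continuous_intros) (auto simp: T_def)
  moreover have "\<forall>\<^sub>F z in nhds (p, u). G (fst z) (snd z) (\<tau> (fst z)) < 0"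
    using neg
    by (intro eventually_continuous_neg[OF contG op mem] continuous_intros continuous_on_compose2[OF \<tau>])
      (auto simp: T_def)
  ultimately have "\<forall>\<^sub>F z in nhds (p, u). G (fst z) (snd z) T < G p u T / 2 \<and> G (fst z) T T < 0 \<and>
      G (fst z) (snd z) (\<tau> (fst z)) < 0"
    by eventually_elim auto
  \<comment> \<open>The strict inequalities at \<open>(p, u)\<close> are open conditions on base
    point and vector together. Halving the bound in the first one leaves a quantitative gain
    nearby.\<close>
  then obtain e where e: "e > 0" and ev: "\<And>z. dist z (p, u) < e \<Longrightarrow>
      G (fst z) (snd z) T < G p u T / 2 \<and> G (fst z) T T < 0 \<and> G (fst z) (snd z) (\<tau> (fst z)) < 0"
    unfolding eventually_nhds_metric by blast
  have loc: "G x w T < G p u T / 2 \<and> G x T T < 0 \<and> G x w (\<tau> x) < 0"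
    if "dist x p < e / 2" "dist w u < e / 2" for x w
  proof -
    have "dist (x, w) (p, u) \<le> dist x p + dist w u"
      using sqrt_sum_squares_le_sum[of "dist x p" "dist w u"] by (simp add: dist_Pair_Pair)
    with that ev[of "(x, w)"] show ?thesis by auto
  qed
  define \<alpha> where "\<alpha> = - G p u T"
  have \<alpha>: "\<alpha> > 0" using neg by (simp add: \<alpha>_def T_def)
  \<comment> \<open>\<open>C\<close> bounds the Lipschitz error, as \<open>norm w\<close> will be at
    most \<open>norm u + 1\<close>. The added 1 here and in \<open>N\<close> keeps the divisors
    below positive.\<close>
  define C where "C = L * (norm u + 1)\<^sup>2 + 1"
  have C: "C \<ge> 1" using r1 by (simp add: C_def)
  define N where "N = norm T + 1"
  \<comment> \<open>\<open>r1\<close> is the range of the Lipschitz bound; \<open>e / 4\<close> and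
    \<open>e / 4 / N\<close> keep the tilted vector within \<open>e / 2\<close> of \<open>u\<close>;
    1 bounds \<open>norm w\<close>; and \<open>\<alpha> / C\<close> makes the error from moving the
    base point at most \<open>\<alpha> * \<epsilon>\<close>.\<close>
  define r where "r = Min {r1, e / 4, 1, e / 4 / N, \<alpha> / C}"
  have N: "N > 0" by (simp add: N_def add_nonneg_pos)
  have r: "r > 0" "r \<le> r1" "r \<le> e / 4" "r \<le> 1" "r \<le> e / 4 / N" "r \<le> \<alpha> / C"
  proof -
    show "r > 0" using r1 e \<alpha> C N by (simp add: r_def)
  qed (simp_all only: r_def, (rule Min_le; simp)+)
  show thesis
  proof (rule that[OF r(1)])
    show "ball p r \<subseteq> S" using r r1 by (auto intro: subset_trans[OF subset_ball])
    fix x y w \<epsilon>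
    assume x: "x \<in> ball p r" and y: "y \<in> ball p r" and w: "w \<in> ball u r"
      and \<epsilon>: "0 < \<epsilon>" "\<epsilon> < r" and xy: "norm (y - x) \<le> r * \<epsilon>" and Gx: "G x w w \<le> 0"
    have yS: "y \<in> S" using y r r1 by auto
    interpret Gy: bounded_bilinear "G y"
      using bil[OF yS] by (simp add: bilinear_conv_bounded_bilinear)
    have wn: "norm w \<le> norm u + 1"
      using w r(4) norm_triangle_sub[of w u] by (simp add: dist_norm norm_minus_commute)
    have dw: "dist w u < e / 2" "dist y p < e / 2"
      using w y r(3) e by (simp_all add: dist_commute)
    have "dist (w + \<epsilon> *\<^sub>R T) u \<le> dist w u + \<epsilon> * norm T"
      using norm_triangle_ineq[of "w - u" "\<epsilon> *\<^sub>R T"] \<epsilon> by (simp add: dist_norm algebra_simps)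
    also have "\<epsilon> * norm T \<le> r * N"
      using \<epsilon> r(1) by (intro mult_mono) (auto simp: N_def)
    also have "r * N \<le> e / 4" using r(5) N by (simp add: field_simps)
    finally have "dist (w + \<epsilon> *\<^sub>R T) u < e / 2"
      using w r(3) by (simp add: dist_commute)
    from loc[OF dw(2) this] have fut: "G y (w + \<epsilon> *\<^sub>R T) (\<tau> y) < 0" by simp
    have "G y w w \<le> G x w w + L * norm (y - x) * (norm w)\<^sup>2"
      using L[of y x w] x y r(2) by auto
    also have "L * norm (y - x) * (norm w)\<^sup>2 \<le> L * (r * \<epsilon>) * (norm u + 1)\<^sup>2"
      using xy wn r1 r \<epsilon> by (intro mult_mono power_mono) auto
    also have "\<dots> \<le> C * (r * \<epsilon>)"
      using r \<epsilon> by (simp add: C_def algebra_simps)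
    also have "\<dots> \<le> \<alpha> * \<epsilon>"
      using r(6) C \<epsilon> by (simp add: field_simps)
    finally have "G y w w \<le> \<alpha> * \<epsilon>" using Gx by simp
    moreover have "2 * \<epsilon> * G y w T \<le> - \<alpha> * \<epsilon>"
      using loc[OF dw(2,1)] \<epsilon> mult_left_mono[of "G y w T" "- \<alpha> / 2" "2 * \<epsilon>"] by (simp add: \<alpha>_def mult.commute)
    moreover have "\<epsilon>\<^sup>2 * G y T T \<le> 0"
      using loc[OF dw(2,1)] by (intro mult_nonneg_nonpos) auto
    \<comment> \<open>The first term is at most \<open>\<alpha> * \<epsilon>\<close>, the cross term
      at most \<open>- \<alpha> * \<epsilon>\<close>, and the last is nonpositive, so the sum is at
      most 0.\<close>
    moreover have "G y (w + \<epsilon> *\<^sub>R T) (w + \<epsilon> *\<^sub>R T) = G y w w + 2 * \<epsilon> * G y w T + \<epsilon>\<^sup>2 * G y T T"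
      using sym[OF yS, of T w]
      by (simp add: Gy.add_left Gy.add_right Gy.scaleR_left Gy.scaleR_right power2_eq_square algebra_simps)
    ultimately show "G y (w + \<epsilon> *\<^sub>R \<tau> p) (w + \<epsilon> *\<^sub>R \<tau> p) \<le> 0 \<and> G y (w + \<epsilon> *\<^sub>R \<tau> p) (\<tau> y) < 0"
      using fut by (simp add: T_def)
  qed
qed

section \<open>Charts and tangent vectors\<close>

lemma chart_inv_chart:
  assumes "is_chart c" "p \<in> fst c"
  shows "chart_inv c (snd c p) = p"
proof -
  obtain \<psi> where "homeomorphism (fst c) (snd c ` fst c) (snd c) \<psi>"
    using assms(1) by (auto simp: is_chart_def)
  then have "inj_on (snd c) (fst c)"
    by (intro inj_on_inverseI[of _ \<psi>]) (rule homeomorphism_apply1)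
  then show ?thesis using assms(2) by (simp add: chart_inv_def)
qed

lemma chart_chart_inv:
  "x \<in> snd c ` fst c \<Longrightarrow> snd c (chart_inv c x) = x"
  "x \<in> snd c ` fst c \<Longrightarrow> chart_inv c x \<in> fst c"
  by (simp_all add: chart_inv_def f_inv_into_f inv_into_into)

text \<open>\<open>is_chart\<close> only asserts that some continuous inverse exists; on the image
  of the chart it agrees with \<open>chart_inv\<close>, which is defined by choice.\<close>

lemma homeomorphism_chart_inv:
  assumes "is_chart c"
  shows "homeomorphism (fst c) (snd c ` fst c) (snd c) (chart_inv c)"
proof -
  from assms obtain \<psi> where "homeomorphism (fst c) (snd c ` fst c) (snd c) \<psi>"
    by (auto simp: is_chart_def)
  note \<psi> = this
  show ?thesis
    by (rule homeomorphism_cong[OF \<psi>]) (use assms in \<open>auto simp: chart_inv_chart homeomorphism_apply1[OF \<psi>]\<close>)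
qed

lemma open_chart_image:
  assumes "is_chart c" "open S"
  shows "open (snd c ` (fst c \<inter> S))"
proof -
  have "openin (top_of_set (snd c ` fst c)) (snd c ` (fst c \<inter> S))"
    using homeomorphism_chart_inv[OF assms(1)]
    by (rule homeomorphism_imp_open_map) (simp add: assms openin_open_Int)
  then show ?thesis using assms(1) openin_open_trans by (auto simp: is_chart_def)
qed

lemma open_chart_vimage:
  assumes "is_chart c" "open B"
  shows "open (fst c \<inter> snd c -` B)"
  using homeomorphism_chart_inv[OF assms(1)] assms
  by (intro continuous_open_preimage) (auto simp: homeomorphism_def is_chart_def)

lemma smooth_atlas_is_chart: "smooth_atlas A \<Longrightarrow> c \<in> A \<Longrightarrow> is_chart c"
  by (simp add: smooth_atlas_def)

lemma transition_smooth:
  "smooth_atlas A \<Longrightarrow> c \<in> A \<Longrightarrow> d \<in> A \<Longrightarrow> smooth_on (snd c ` (fst c \<inter> fst d)) (transition c d)"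
  by (simp add: smooth_atlas_def)

lemma transition_has_derivative:
  assumes "smooth_atlas A" "c \<in> A" "d \<in> A" "p \<in> fst c" "p \<in> fst d"
  shows "(transition c d has_derivative frechet_derivative (transition c d) (at (snd c p))) (at (snd c p))"
  using assms by (intro smooth_on_has_derivative[OF transition_smooth]) auto

lemma transition_chart:
  "is_chart c \<Longrightarrow> p \<in> fst c \<Longrightarrow> transition c d (snd c p) = snd d p"
  by (simp add: transition_def chart_inv_chart)

lemma transition_derivative_comp:
  assumes A: "smooth_atlas A" and "c \<in> A" "d \<in> A" "e \<in> A" and p: "p \<in> fst c" "p \<in> fst d" "p \<in> fst e"
  shows "frechet_derivative (transition c e) (at (snd c p)) a =
    frechet_derivative (transition d e) (at (snd d p)) (frechet_derivative (transition c d) (at (snd c p)) a)"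
proof -
  have c: "is_chart c" and d: "is_chart d" using assms by (auto intro: smooth_atlas_is_chart)
  have N: "open (snd c ` (fst c \<inter> fst d))"
    using c d by (intro open_chart_image) (auto simp: is_chart_def)
  have "(transition d e has_derivative frechet_derivative (transition d e) (at (snd d p)))
      (at (transition c d (snd c p)))"
    using transition_has_derivative[OF A \<open>d \<in> A\<close> \<open>e \<in> A\<close> p(2,3)] by (simp add: transition_chart c p)
  from diff_chain_at[OF transition_has_derivative[OF A \<open>c \<in> A\<close> \<open>d \<in> A\<close> p(1,2)] this]
  have "(transition c e has_derivative frechet_derivative (transition d e) (at (snd d p)) \<circ>
      frechet_derivative (transition c d) (at (snd c p))) (at (snd c p))"
    by (rule has_derivative_transform_within_open[OF _ N]) (use p c d in \<open>auto simp: transition_chart\<close>)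
  from frechet_derivative_at[OF this] show ?thesis by (metis comp_apply)
qed

lemma transition_derivative_self:
  assumes A: "smooth_atlas A" and "c \<in> A" and p: "p \<in> fst c"
  shows "frechet_derivative (transition c c) (at (snd c p)) a = a"
proof -
  have c: "is_chart c" using assms by (auto intro: smooth_atlas_is_chart)
  have "(transition c c has_derivative (\<lambda>x. x)) (at (snd c p))"
  proof (rule has_derivative_transform_within_open[OF has_derivative_ident])
    show "open (snd c ` fst c)" using c by (simp add: is_chart_def)
  qed (use p in \<open>auto simp: transition_chart[OF c]\<close>)
  from frechet_derivative_at[OF this] show ?thesis by metis
qed

section \<open>Coordinate vectors and curves written in a chart\<close>

lemma coord_vector_in_tangent_space:
  assumes "smooth_atlas A" "c \<in> A" "p \<in> fst c"
  shows "coord_vector A c p a \<in> tangent_space A p"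
  unfolding tangent_space_def
proof (intro CollectI conjI ballI allI impI; (elim conjE)?)
  fix d e assume "d \<in> A" "e \<in> A" "p \<in> fst d" "p \<in> fst e"
  then show "coord_vector A c p a e = frechet_derivative (transition d e) (at (snd d p)) (coord_vector A c p a d)"
    using transition_derivative_comp[OF assms(1,2) \<open>d \<in> A\<close> \<open>e \<in> A\<close> assms(3)] by (simp add: coord_vector_def)
qed (auto simp: coord_vector_def)

lemma coord_vector_self:
  "smooth_atlas A \<Longrightarrow> c \<in> A \<Longrightarrow> p \<in> fst c \<Longrightarrow> coord_vector A c p a c = a"
  by (simp add: coord_vector_def transition_derivative_self)

lemma tangent_eq_coord_vector:
  assumes "v \<in> tangent_space A p" "c \<in> A" "p \<in> fst c"
  shows "coord_vector A c p (v c) = v"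
proof
  fix d
  have "d \<in> A \<and> p \<in> fst d \<Longrightarrow> v d = frechet_derivative (transition c d) (at (snd c p)) (v c)"
    and "\<not> (d \<in> A \<and> p \<in> fst d) \<Longrightarrow> v d = 0"
    using assms unfolding tangent_space_def mem_Collect_eq by blast+
  then show "coord_vector A c p (v c) d = v d"
    by (auto simp: coord_vector_def)
qed

text \<open>One chart suffices to check that a curve is C1: in any other chart the velocity is given
  by the chain rule through the transition map, and it is continuous because the transition map is
  smooth.\<close>

lemma C1_curve_chart:
  assumes A: "smooth_atlas (atlas M)" and c: "c \<in> atlas M"
    and \<eta>: "\<And>t. t \<in> {a..b} \<Longrightarrow> (\<eta> has_vector_derivative \<eta>' t) (at t within {a..b})"
    and cont: "continuous_on {a..b} \<eta>'" and im: "\<And>t. t \<in> {a..b} \<Longrightarrow> \<eta> t \<in> snd c ` fst c"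
  shows "C1_curve M a b (\<lambda>t. chart_inv c (\<eta> t)) (\<lambda>t. coord_vector (atlas M) c (chart_inv c (\<eta> t)) (\<eta>' t))"
  unfolding C1_curve_def
proof (intro conjI ballI impI)
  have ch: "is_chart c" using A c by (rule smooth_atlas_is_chart)
  have \<eta>c: "continuous_on {a..b} \<eta>"
    using \<eta> by (meson continuous_on_eq_continuous_within has_vector_derivative_continuous)
  show "continuous_on {a..b} (\<lambda>t. chart_inv c (\<eta> t))"
    using homeomorphism_chart_inv[OF ch] im
    by (intro continuous_on_compose2[OF _ \<eta>c, of "snd c ` fst c"]) (auto simp: homeomorphism_def)
  fix t assume t: "t \<in> {a..b}"
  then show "coord_vector (atlas M) c (chart_inv c (\<eta> t)) (\<eta>' t) \<in> tangent_space (atlas M) (chart_inv c (\<eta> t))"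
    using im by (intro coord_vector_in_tangent_space A c chart_chart_inv(2))
next
  fix d t assume d: "d \<in> atlas M" and t: "t \<in> {a..b}" and td: "chart_inv c (\<eta> t) \<in> fst d"
  have tc: "chart_inv c (\<eta> t) \<in> fst c" "snd c (chart_inv c (\<eta> t)) = \<eta> t"
    using chart_chart_inv[OF im[OF t]] by auto
  have "(transition c d has_derivative frechet_derivative (transition c d) (at (\<eta> t))) (at (\<eta> t))"
    using transition_has_derivative[OF A c d tc(1) td] by (simp add: tc)
  then have "(transition c d has_derivative frechet_derivative (transition c d) (at (\<eta> t)))
      (at (\<eta> t) within \<eta> ` {a..b})"
    by (rule has_derivative_at_withinI)
  from vector_derivative_diff_chain_within[OF \<eta>[OF t] this]
  show "((\<lambda>s. snd d (chart_inv c (\<eta> s))) has_vector_derivative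
      coord_vector (atlas M) c (chart_inv c (\<eta> t)) (\<eta>' t) d) (at t within {a..b})"
    using d td by (simp add: coord_vector_def tc transition_def comp_def)
next
  fix d assume d: "d \<in> atlas M"
  let ?X = "{t \<in> {a..b}. chart_inv c (\<eta> t) \<in> fst d}"
  have \<eta>c: "continuous_on {a..b} \<eta>"
    using \<eta> by (meson continuous_on_eq_continuous_within has_vector_derivative_continuous)
  have "continuous_on ?X (\<lambda>t. frechet_derivative (transition c d) (at (\<eta> t)) (\<eta>' t))"
  proof (rule smooth_on_continuous_derivative_compose[OF transition_smooth[OF A c d]])
    show "continuous_on ?X \<eta>" "continuous_on ?X \<eta>'"
      using \<eta>c cont by (auto elim: continuous_on_subset)
    show "\<eta> ` ?X \<subseteq> snd c ` (fst c \<inter> fst d)"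
    proof clarify
      fix t assume "t \<in> {a..b}" "chart_inv c (\<eta> t) \<in> fst d"
      then show "\<eta> t \<in> snd c ` (fst c \<inter> fst d)"
        using chart_chart_inv[OF im] by (intro image_eqI[of _ _ "chart_inv c (\<eta> t)"]) auto
    qed
  qed
  then show "continuous_on ?X (\<lambda>t. coord_vector (atlas M) c (chart_inv c (\<eta> t)) (\<eta>' t) d)"
    by (rule continuous_on_eq) (use d chart_chart_inv(1)[OF im] in \<open>auto simp: coord_vector_def\<close>)
qed

section \<open>Causal curves\<close>

text \<open>The one-piece case of \<open>causal_curve\<close>. It makes \<open>causal_le\<close> a
  reflexive transitive closure, so that claims about causal curves follow by induction over their
  pieces.\<close>

definition causal_step ::
    "('m::topological_space, 'e::euclidean_space) spacetime \<Rightarrow> 'm \<Rightarrow> 'm \<Rightarrow> bool" where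
  "causal_step M x y \<longleftrightarrow> (\<exists>a b \<gamma> v. a < b \<and> C1_curve M a b \<gamma> v \<and>
     (\<forall>t\<in>{a..b}. causal_vector M (\<gamma> t) (v t) \<and> future_directed M (\<gamma> t) (v t)) \<and> \<gamma> a = x \<and> \<gamma> b = y)"

lemma C1_curveD:
  assumes "C1_curve M a b \<gamma> v"
  shows "continuous_on {a..b} \<gamma>"
    and "t \<in> {a..b} \<Longrightarrow> v t \<in> tangent_space (atlas M) (\<gamma> t)"
    and "c \<in> atlas M \<Longrightarrow> t \<in> {a..b} \<Longrightarrow> \<gamma> t \<in> fst c \<Longrightarrow>
      ((\<lambda>s. snd c (\<gamma> s)) has_vector_derivative v t c) (at t within {a..b})"
    and "c \<in> atlas M \<Longrightarrow> continuous_on {t \<in> {a..b}. \<gamma> t \<in> fst c} (\<lambda>t. v t c)"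
  using assms by (simp_all add: C1_curve_def)

lemma C1_curve_cong:
  assumes \<gamma>: "C1_curve M a b \<gamma> v" and eq: "\<And>t. t \<in> {a..b} \<Longrightarrow> \<gamma> t = \<gamma>' t"
  shows "C1_curve M a b \<gamma>' v"
  unfolding C1_curve_def
proof (intro conjI ballI impI)
  show "continuous_on {a..b} \<gamma>'"
    using C1_curveD(1)[OF \<gamma>] eq by (rule continuous_on_eq)
  show "v t \<in> tangent_space (atlas M) (\<gamma>' t)" if "t \<in> {a..b}" for t
    using C1_curveD(2)[OF \<gamma> that] eq[OF that] by simp
next
  fix c t assume c: "c \<in> atlas M" and t: "t \<in> {a..b}" "\<gamma>' t \<in> fst c"
  then have "((\<lambda>s. snd c (\<gamma> s)) has_vector_derivative v t c) (at t within {a..b})"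
    using eq by (intro C1_curveD(3)[OF \<gamma>]) auto
  then show "((\<lambda>s. snd c (\<gamma>' s)) has_vector_derivative v t c) (at t within {a..b})"
    by (rule has_vector_derivative_transform[rotated 2]) (use eq t in auto)
next
  fix c assume c: "c \<in> atlas M"
  have "{t \<in> {a..b}. \<gamma>' t \<in> fst c} = {t \<in> {a..b}. \<gamma> t \<in> fst c}" using eq by auto
  then show "continuous_on {t \<in> {a..b}. \<gamma>' t \<in> fst c} (\<lambda>t. v t c)"
    using C1_curveD(4)[OF \<gamma> c] by simp
qed

text \<open>Used to match the parameters of two curves at their junction.\<close>

lemma C1_curve_shift:
  assumes \<gamma>: "C1_curve M a b \<gamma> v"
  shows "C1_curve M (a + s) (b + s) (\<lambda>t. \<gamma> (t - s)) (\<lambda>t. v (t - s))"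
  unfolding C1_curve_def
proof (intro conjI ballI impI)
  have im: "(\<lambda>t. t - s) ` {a + s..b + s} = {a..b}" by simp
  show "continuous_on {a + s..b + s} (\<lambda>t. \<gamma> (t - s))"
    by (intro continuous_on_compose2[OF C1_curveD(1)[OF \<gamma>]] continuous_intros) auto
  show "v (t - s) \<in> tangent_space (atlas M) (\<gamma> (t - s))" if "t \<in> {a + s..b + s}" for t
    using that by (intro C1_curveD(2)[OF \<gamma>]) auto
  fix c assume c: "c \<in> atlas M"
  show "continuous_on {t \<in> {a + s..b + s}. \<gamma> (t - s) \<in> fst c} (\<lambda>t. v (t - s) c)"
    by (intro continuous_on_compose2[OF C1_curveD(4)[OF \<gamma> c]] continuous_intros) auto
  fix t assume "t \<in> {a + s..b + s}" "\<gamma> (t - s) \<in> fst c"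
  then have d: "((\<lambda>u. snd c (\<gamma> u)) has_vector_derivative v (t - s) c)
      (at (t - s) within (\<lambda>t. t - s) ` {a + s..b + s})"
    unfolding im by (intro C1_curveD(3)[OF \<gamma> c]) auto
  have "((\<lambda>t. t - s) has_vector_derivative 1) (at t within {a + s..b + s})"
    by (auto intro!: derivative_eq_intros)
  from vector_diff_chain_within[OF this d]
  show "((\<lambda>u. snd c (\<gamma> (u - s))) has_vector_derivative v (t - s) c) (at t within {a + s..b + s})"
    by (simp add: comp_def)
qed

lemma causal_step_imp_causal_le:
  assumes "causal_step M x y" shows "causal_le M x y"
proof -
  obtain a b \<gamma> v where "a < b" "C1_curve M a b \<gamma> v" "\<gamma> a = x" "\<gamma> b = y"
    "\<forall>t\<in>{a..b}. causal_vector M (\<gamma> t) (v t) \<and> future_directed M (\<gamma> t) (v t)"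
    using assms unfolding causal_step_def by blast
  then have "causal_curve M a b \<gamma>"
    unfolding causal_curve_def by (intro exI[of _ "[a, b]"]) (auto simp: less_Suc_eq)
  then show ?thesis using \<open>\<gamma> a = x\<close> \<open>\<gamma> b = y\<close> by (auto simp: causal_le_def)
qed

text \<open>Concatenation: the single piece is put in front of the given curve, whose parameter is
  shifted to start at \<open>b\<close>. The junction becomes a break point, so the velocities need
  not agree there.\<close>

lemma causal_step_causal_le_trans:
  assumes "causal_step M x y" "causal_le M y z" shows "causal_le M x z"
proof (cases "y = z")
  case False
  obtain a b \<gamma> v where \<gamma>: "a < b" "C1_curve M a b \<gamma> v" "\<gamma> a = x" "\<gamma> b = y"
    "\<And>t. t \<in> {a..b} \<Longrightarrow> causal_vector M (\<gamma> t) (v t) \<and> future_directed M (\<gamma> t) (v t)"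
    using assms(1) unfolding causal_step_def by blast
  obtain a' b' \<gamma>' where \<gamma>': "causal_curve M a' b' \<gamma>'" "\<gamma>' a' = y" "\<gamma>' b' = z"
    using assms(2) False by (auto simp: causal_le_def)
  obtain ts where ts: "sorted_wrt (<) ts" "length ts \<ge> 2" "hd ts = a'" "last ts = b'"
    and pc: "\<And>i. Suc i < length ts \<Longrightarrow> \<exists>v. C1_curve M (ts ! i) (ts ! Suc i) \<gamma>' v \<and>
           (\<forall>t\<in>{ts ! i..ts ! Suc i}. causal_vector M (\<gamma>' t) (v t) \<and> future_directed M (\<gamma>' t) (v t))"
    using \<gamma>'(1) unfolding causal_curve_def by blast
  have ne: "ts \<noteq> []" using ts(2) by auto
  have ge: "a' \<le> ts ! i" if "i < length ts" for i
    using ts(3) sorted_wrt_nth_less[OF ts(1), of 0 i] that ne by (cases i) (auto simp: hd_conv_nth)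
  define s where "s = b - a'"
  define \<sigma> where "\<sigma> t = (if t \<le> b then \<gamma> t else \<gamma>' (t - s))" for t
  define us where "us = a # map (\<lambda>t. t + s) ts"
  have \<sigma>1: "\<sigma> t = \<gamma> t" if "t \<in> {a..b}" for t using that by (simp add: \<sigma>_def)
  \<comment> \<open>Both branches take the value \<open>y\<close> at \<open>t = b\<close>, so on the
    closed pieces from \<open>b\<close> onwards \<open>\<sigma>\<close> is the shifted second
    curve.\<close>
  have \<sigma>2: "\<sigma> t = \<gamma>' (t - s)" if "t \<ge> b" for t
    using that \<gamma>(4) \<gamma>'(2) by (cases "t = b") (auto simp: \<sigma>_def s_def)
  have "causal_curve M a (b' + s) \<sigma>"
    unfolding causal_curve_def
  proof (intro exI[of _ us] conjI allI impI)
    have "a < t + s" if "t \<in> set ts" for t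
      using that ge \<gamma>(1) by (force simp: in_set_conv_nth s_def)
    then show "sorted_wrt (<) us" using ts(1) by (auto simp: us_def sorted_wrt_map)
    show "2 \<le> length us" "hd us = a" "last us = b' + s"
      using ts ne by (auto simp: us_def last_map)
    fix i assume i: "Suc i < length us"
    show "\<exists>v. C1_curve M (us ! i) (us ! Suc i) \<sigma> v \<and>
        (\<forall>t\<in>{us ! i..us ! Suc i}. causal_vector M (\<sigma> t) (v t) \<and> future_directed M (\<sigma> t) (v t))"
    proof (cases i)
      case 0
      have "us ! i = a" "us ! Suc i = b"
        using ts(3) ne by (auto simp: 0 us_def s_def hd_conv_nth)
      then show ?thesis
        using C1_curve_cong[OF \<gamma>(2), of \<sigma>] \<sigma>1 \<gamma>(5) by auto
    next
      case (Suc j)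
      then have j: "Suc j < length ts" using i by (simp add: us_def)
      then have us: "us ! i = ts ! j + s" "us ! Suc i = ts ! Suc j + s" by (auto simp: Suc us_def)
      have b: "b \<le> t" if "t \<in> {ts ! j + s..ts ! Suc j + s}" for t
        using ge[of j] j that by (auto simp: s_def)
      obtain w where w: "C1_curve M (ts ! j) (ts ! Suc j) \<gamma>' w"
        "\<forall>t\<in>{ts ! j..ts ! Suc j}. causal_vector M (\<gamma>' t) (w t) \<and> future_directed M (\<gamma>' t) (w t)"
        using pc[OF j] by blast
      have "C1_curve M (ts ! j + s) (ts ! Suc j + s) \<sigma> (\<lambda>t. w (t - s))"
        by (rule C1_curve_cong[OF C1_curve_shift[OF w(1)]]) (simp add: \<sigma>2 b)
      moreover have "\<forall>t\<in>{ts ! j + s..ts ! Suc j + s}.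
          causal_vector M (\<sigma> t) (w (t - s)) \<and> future_directed M (\<sigma> t) (w (t - s))"
        using w(2) by (auto simp: \<sigma>2 b)
      ultimately show ?thesis unfolding us by blast
    qed
  qed
  moreover have "a' < b'"
    using sorted_wrt_nth_less[OF ts(1), of 0 "length ts - 1"] ts(2-4) ne
    by (auto simp: hd_conv_nth last_conv_nth)
  then have "\<sigma> a = x" "\<sigma> (b' + s) = z"
    using \<sigma>1[of a] \<sigma>2[of "b' + s"] \<gamma> \<gamma>' by (auto simp: s_def)
  ultimately show ?thesis by (auto simp: causal_le_def)
qed (use assms(1) causal_step_imp_causal_le in auto)

text \<open>A causal curve is cut at its break points. Conversely, steps are prepended one at a
  time, hence the induction from the left end. Transitivity of \<open>causal_le\<close> comes for
  free.\<close>

lemma causal_le_eq_rtranclp: "causal_le M = (causal_step M)\<^sup>*\<^sup>*"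
proof (intro ext iffI)
  fix x y assume "causal_le M x y"
  then consider "x = y" | a b \<gamma> where "causal_curve M a b \<gamma>" "\<gamma> a = x" "\<gamma> b = y"
    by (auto simp: causal_le_def)
  then show "(causal_step M)\<^sup>*\<^sup>* x y"
  proof cases
    case 2
    obtain ts where ts: "sorted_wrt (<) ts" "length ts \<ge> 2" "hd ts = a" "last ts = b"
      and pc: "\<And>i. Suc i < length ts \<Longrightarrow> \<exists>v. C1_curve M (ts ! i) (ts ! Suc i) \<gamma> v \<and>
           (\<forall>t\<in>{ts ! i..ts ! Suc i}. causal_vector M (\<gamma> t) (v t) \<and> future_directed M (\<gamma> t) (v t))"
      using 2(1) unfolding causal_curve_def by blast
    have "i < length ts \<Longrightarrow> (causal_step M)\<^sup>*\<^sup>* (\<gamma> (ts ! 0)) (\<gamma> (ts ! i))" for i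
    proof (induction i)
      case (Suc i)
      have "causal_step M (\<gamma> (ts ! i)) (\<gamma> (ts ! Suc i))"
        using pc[OF Suc.prems] sorted_wrt_nth_less[OF ts(1), of i "Suc i"] Suc.prems
        unfolding causal_step_def by blast
      with Suc show ?case by (auto intro: rtranclp.rtrancl_into_rtrancl)
    qed simp
    from this[of "length ts - 1"] show ?thesis
      using ts 2 by (cases ts) (auto simp: last_conv_nth)
  qed simp
next
  fix x y assume "(causal_step M)\<^sup>*\<^sup>* x y"
  then show "causal_le M x y"
    by (induction rule: converse_rtranclp_induct)
      (auto simp: causal_le_def[of M y y] intro: causal_step_causal_le_trans)
qed

lemma causal_le_refl: "causal_le M x x"
  by (simp add: causal_le_eq_rtranclp)

lemma causal_le_trans: "causal_le M x y \<Longrightarrow> causal_le M y z \<Longrightarrow> causal_le M x z"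
  by (simp add: causal_le_eq_rtranclp)

section \<open>Futures and pasts of open sets are open\<close>

text \<open>The coordinate expression of the metric at \<open>x\<close>, as a bilinear form on the
  model space; its values on basis vectors are the usual coefficients g_ij.\<close>

definition coord_metric ::
    "('m, 'e::euclidean_space) spacetime \<Rightarrow> ('m, 'e) chart \<Rightarrow> 'e \<Rightarrow> 'e \<Rightarrow> 'e \<Rightarrow> real" where
  "coord_metric M c x a b = metric M (chart_inv c x)
     (coord_vector (atlas M) c (chart_inv c x) a) (coord_vector (atlas M) c (chart_inv c x) b)"

context
  fixes M :: "('m::{t2_space,second_countable_topology}, 'e::euclidean_space) spacetime"
  assumes M: "smooth_spacetime M"
begin

lemma smooth_atlas_M: "smooth_atlas (atlas M)"
  using M by (simp add: smooth_spacetime_def)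

lemmas is_chart_M = smooth_atlas_is_chart[OF smooth_atlas_M]

lemma coord_metric_bilinear_sym:
  assumes c: "c \<in> atlas M" and x: "x \<in> snd c ` fst c"
  shows "bilinear (coord_metric M c x)" "coord_metric M c x a b = coord_metric M c x b a"
proof -
  have "lorentzian_metric (atlas M) (metric M)" using M by (simp add: smooth_spacetime_def)
  then have "lorentzian_form (coord_metric M c x)"
    using c chart_chart_inv(2)[OF x] unfolding lorentzian_metric_def coord_metric_def by blast
  then show "bilinear (coord_metric M c x)" "coord_metric M c x a b = coord_metric M c x b a"
    by (simp_all add: lorentzian_form_def)
qed

lemma coord_metric_smooth:
  assumes "c \<in> atlas M"
  shows "smooth_on (snd c ` fst c) (\<lambda>x. coord_metric M c x a b)"
proof -
  have "lorentzian_metric (atlas M) (metric M)" using M by (simp add: smooth_spacetime_def)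
  then show ?thesis
    using assms unfolding lorentzian_metric_def coord_metric_def Let_def by blast
qed

lemma time_field_tangent: "time_field M p \<in> tangent_space (atlas M) p"
  and time_field_timelike: "metric M p (time_field M p) (time_field M p) < 0"
  and time_field_continuous: "c \<in> atlas M \<Longrightarrow> continuous_on (fst c) (\<lambda>p. time_field M p c)"
  using M by (simp_all add: smooth_spacetime_def time_orientation_def)

lemma metric_eq_coord_metric:
  assumes "c \<in> atlas M" "p \<in> fst c" "v \<in> tangent_space (atlas M) p" "w \<in> tangent_space (atlas M) p"
  shows "metric M p v w = coord_metric M c (snd c p) (v c) (w c)"
  using assms by (simp add: coord_metric_def chart_inv_chart is_chart_M tangent_eq_coord_vector)

text \<open>Reduces the construction of a causal step to inequalities between vectors of the model
  space.\<close>

lemma causal_step_chart: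
  assumes c: "c \<in> atlas M" and ab: "a < b"
    and \<eta>: "\<And>t. t \<in> {a..b} \<Longrightarrow> (\<eta> has_vector_derivative \<eta>' t) (at t within {a..b})"
    and cont: "continuous_on {a..b} \<eta>'" and im: "\<And>t. t \<in> {a..b} \<Longrightarrow> \<eta> t \<in> snd c ` fst c"
    and causal: "\<And>t. t \<in> {a..b} \<Longrightarrow> coord_metric M c (\<eta> t) (\<eta>' t) (\<eta>' t) \<le> 0"
    and future: "\<And>t. t \<in> {a..b} \<Longrightarrow>
      coord_metric M c (\<eta> t) (\<eta>' t) (time_field M (chart_inv c (\<eta> t)) c) < 0"
  shows "causal_step M (chart_inv c (\<eta> a)) (chart_inv c (\<eta> b))"
proof -
  define v where "v t = coord_vector (atlas M) c (chart_inv c (\<eta> t)) (\<eta>' t)" for t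
  have "causal_vector M (chart_inv c (\<eta> t)) (v t) \<and> future_directed M (chart_inv c (\<eta> t)) (v t)"
    if t: "t \<in> {a..b}" for t
  proof -
    have tc: "chart_inv c (\<eta> t) \<in> fst c" "snd c (chart_inv c (\<eta> t)) = \<eta> t"
      using chart_chart_inv[OF im[OF t]] by auto
    have vt: "v t \<in> tangent_space (atlas M) (chart_inv c (\<eta> t))"
      unfolding v_def by (rule coord_vector_in_tangent_space[OF smooth_atlas_M c tc(1)])
    have vc: "v t c = \<eta>' t"
      unfolding v_def by (rule coord_vector_self[OF smooth_atlas_M c tc(1)])
    \<comment> \<open>A vector with strictly negative product with the time field cannot
      vanish.\<close>
    have "v t \<noteq> (\<lambda>_. 0)"
    proof
      assume "v t = (\<lambda>_. 0)"
      then have "\<eta>' t = 0" using vc by simp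
      then show False using future[OF t] coord_metric_bilinear_sym(1)[OF c im[OF t]]
        by (simp add: bilinear_lzero)
    qed
    moreover have "metric M (chart_inv c (\<eta> t)) (v t) (v t) \<le> 0"
      using causal[OF t] by (simp add: metric_eq_coord_metric[OF c tc(1) vt vt] vc tc)
    moreover have "metric M (chart_inv c (\<eta> t)) (v t) (time_field M (chart_inv c (\<eta> t))) < 0"
      using future[OF t] by (simp add: metric_eq_coord_metric[OF c tc(1) vt time_field_tangent] vc tc)
    ultimately show ?thesis using vt by (simp add: causal_vector_def future_directed_def)
  qed
  moreover have "C1_curve M a b (\<lambda>t. chart_inv c (\<eta> t)) v"
    unfolding v_def using \<eta> cont im by (rule C1_curve_chart[OF smooth_atlas_M c])
  ultimately show ?thesis unfolding causal_step_def using ab by blast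
qed

text \<open>In a chart around \<open>\<gamma> t0\<close>, adding
  \<open>\<epsilon> *\<^sub>R (t - e) *\<^sub>R T + z\<close> to the curve adds
  \<open>\<epsilon> *\<^sub>R T\<close> to its velocity, while the displacement is at most a small
  multiple of \<open>\<epsilon>\<close>; this is the regime of
  \<open>causal_vector_perturbation\<close>. At the parameter \<open>e\<close> the tilt vanishes and
  only the translation \<open>z\<close> remains, so \<open>e\<close> can be chosen as the end that
  is to be prescribed.\<close>

lemma causal_curve_perturbation:
  assumes \<gamma>: "C1_curve M s s' \<gamma> v" and t0: "t0 \<in> {s..s'}"
    and causal: "\<And>t. t \<in> {s..s'} \<Longrightarrow> causal_vector M (\<gamma> t) (v t) \<and> future_directed M (\<gamma> t) (v t)"
  obtains c T \<delta> where "c \<in> atlas M" "\<delta> > 0" "\<And>t. t \<in> {s..s'} \<Longrightarrow> \<bar>t - t0\<bar> < \<delta> \<Longrightarrow> \<gamma> t \<in> fst c"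
    "\<And>a b e \<epsilon> z. s \<le> a \<Longrightarrow> a < b \<Longrightarrow> b \<le> s' \<Longrightarrow> \<bar>a - t0\<bar> < \<delta> \<Longrightarrow> \<bar>b - t0\<bar> < \<delta> \<Longrightarrow> e \<in> {a..b} \<Longrightarrow>
       0 < \<epsilon> \<Longrightarrow> \<epsilon> < \<delta> \<Longrightarrow> norm z \<le> \<delta> * \<epsilon> \<Longrightarrow>
       causal_step M (chart_inv c (snd c (\<gamma> a) + \<epsilon> *\<^sub>R (a - e) *\<^sub>R T + z))
         (chart_inv c (snd c (\<gamma> b) + \<epsilon> *\<^sub>R (b - e) *\<^sub>R T + z))"
proof -
  obtain c where c: "c \<in> atlas M" "\<gamma> t0 \<in> fst c"
    using smooth_atlas_M unfolding smooth_atlas_def by blast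
  note ch = is_chart_M[OF c(1)]
  define S where "S = snd c ` fst c"
  define p where "p = snd c (\<gamma> t0)"
  define \<tau> where "\<tau> x = time_field M (chart_inv c x) c" for x
  define u where "u = v t0 c"
  have S: "open S" "p \<in> S" using ch c by (auto simp: S_def p_def is_chart_def)
  have pt: "chart_inv c p = \<gamma> t0" using chart_inv_chart[OF ch c(2)] by (simp add: p_def)
  have vt: "v t \<in> tangent_space (atlas M) (\<gamma> t)" if "t \<in> {s..s'}" for t
    using C1_curveD(2)[OF \<gamma>] that by auto
  have "continuous_on S \<tau>"
    unfolding \<tau>_def using homeomorphism_chart_inv[OF ch]
    by (intro continuous_on_compose2[OF time_field_continuous[OF c(1)]]) (auto simp: homeomorphism_def S_def)
  moreover have "coord_metric M c p u (\<tau> p) < 0"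
    using causal[OF t0] metric_eq_coord_metric[OF c vt[OF t0] time_field_tangent]
    by (simp add: future_directed_def \<tau>_def u_def pt p_def[symmetric])
  moreover have "coord_metric M c p (\<tau> p) (\<tau> p) < 0"
    using time_field_timelike[of "\<gamma> t0"] metric_eq_coord_metric[OF c time_field_tangent time_field_tangent]
    by (simp add: \<tau>_def u_def pt p_def[symmetric])
  ultimately obtain r where r: "r > 0" "ball p r \<subseteq> S"
    and pert: "\<And>x y w \<epsilon>. x \<in> ball p r \<Longrightarrow> y \<in> ball p r \<Longrightarrow> w \<in> ball u r \<Longrightarrow> 0 < \<epsilon> \<Longrightarrow> \<epsilon> < r \<Longrightarrow>
       norm (y - x) \<le> r * \<epsilon> \<Longrightarrow> coord_metric M c x w w \<le> 0 \<Longrightarrow>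
       coord_metric M c y (w + \<epsilon> *\<^sub>R \<tau> p) (w + \<epsilon> *\<^sub>R \<tau> p) \<le> 0 \<and> coord_metric M c y (w + \<epsilon> *\<^sub>R \<tau> p) (\<tau> y) < 0"
    using causal_vector_perturbation[OF S, of "coord_metric M c" \<tau> u]
      coord_metric_bilinear_sym[OF c(1)] coord_metric_smooth[OF c(1)] unfolding S_def by blast
  \<comment> \<open>Half the radius is reserved for the displacement of the perturbed curve.\<close>
  have "open (fst c \<inter> snd c -` ball p (r / 2))" by (rule open_chart_vimage[OF ch]) simp
  moreover have "(\<gamma> \<longlongrightarrow> \<gamma> t0) (at t0 within {s..s'})"
    using C1_curveD(1)[OF \<gamma>] t0 by (simp add: continuous_on_def)
  ultimately have "\<forall>\<^sub>F t in at t0 within {s..s'}. \<gamma> t \<in> fst c \<inter> snd c -` ball p (r / 2)"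
    using c(2) r(1) by (intro topological_tendstoD) (auto simp: p_def)
  then obtain d1 where d1: "d1 > 0"
    "\<And>t. t \<in> {s..s'} \<Longrightarrow> \<bar>t - t0\<bar> < d1 \<Longrightarrow> \<gamma> t \<in> fst c \<inter> snd c -` ball p (r / 2)"
    using c(2) r(1) unfolding eventually_at by (force simp: dist_real_def p_def)
  obtain d2 where d2: "d2 > 0"
    "\<And>t. t \<in> {s..s'} \<Longrightarrow> \<gamma> t \<in> fst c \<Longrightarrow> \<bar>t - t0\<bar> < d2 \<Longrightarrow> dist (v t c) u < r"
    using C1_curveD(4)[OF \<gamma> c(1)] t0 c(2) r(1) unfolding continuous_on_iff u_def dist_real_def
    by (metis (mono_tags, lifting) mem_Collect_eq)
  define T where "T = \<tau> p"
  define N where "N = norm T + 1"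
  have N: "N > 0" by (simp add: N_def add_nonneg_pos)
  \<comment> \<open>\<open>d1\<close> and \<open>d2\<close> control the points and velocities of the
    curve; \<open>r / 4 / N\<close> and \<open>r / 2\<close> give the tilt and the translation at
    most \<open>r * \<epsilon> / 2\<close> each; and \<open>1 / 2\<close> bounds the total
    \<open>r * \<epsilon>\<close> by \<open>r / 2\<close>.\<close>
  define \<delta> where "\<delta> = Min {d1, d2, r / 2, r / 4 / N, 1 / 2}"
  have \<delta>: "\<delta> > 0" "\<delta> \<le> d1" "\<delta> \<le> d2" "\<delta> \<le> r / 2" "\<delta> \<le> r / 4 / N" "\<delta> \<le> 1 / 2"
  proof -
    show "\<delta> > 0" using d1 d2 r N by (simp add: \<delta>_def)
  qed (simp_all only: \<delta>_def, (rule Min_le; simp)+)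
  show thesis
  proof (rule that[OF c(1) \<delta>(1)])
    show "\<gamma> t \<in> fst c" if "t \<in> {s..s'}" "\<bar>t - t0\<bar> < \<delta>" for t
      using d1(2)[of t] that \<delta>(2) by auto
    fix a b e \<epsilon> :: real and z :: 'e
    assume ab: "s \<le> a" "a < b" "b \<le> s'" "\<bar>a - t0\<bar> < \<delta>" "\<bar>b - t0\<bar> < \<delta>" and e: "e \<in> {a..b}"
      and \<epsilon>: "0 < \<epsilon>" "\<epsilon> < \<delta>" and z: "norm z \<le> \<delta> * \<epsilon>"
    define \<eta> where "\<eta> t = snd c (\<gamma> t) + \<epsilon> *\<^sub>R (t - e) *\<^sub>R T + z" for t
    have tt: "t \<in> {s..s'}" "\<bar>t - t0\<bar> < \<delta>" "\<gamma> t \<in> fst c" "dist p (snd c (\<gamma> t)) < r / 2" "v t c \<in> ball u r"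
      if "t \<in> {a..b}" for t
    proof -
      show t: "t \<in> {s..s'}" "\<bar>t - t0\<bar> < \<delta>" using that ab by auto
      then show "\<gamma> t \<in> fst c" "dist p (snd c (\<gamma> t)) < r / 2" using d1(2)[of t] \<delta>(2) by auto
      then show "v t c \<in> ball u r" using d2(2)[of t] t \<delta>(3) by (simp add: dist_commute)
    qed
    have near: "norm (\<eta> t - snd c (\<gamma> t)) \<le> r * \<epsilon>" if "t \<in> {a..b}" for t
    proof -
      have "norm (\<eta> t - snd c (\<gamma> t)) \<le> \<epsilon> * \<bar>t - e\<bar> * norm T + norm z"
        using norm_triangle_ineq[of "\<epsilon> *\<^sub>R (t - e) *\<^sub>R T" z] \<epsilon> by (simp add: \<eta>_def abs_mult)
      \<comment> \<open>All parameters lie within \<open>\<delta>\<close> of \<open>t0\<close>, so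
        \<open>t\<close> and \<open>e\<close> differ by at most \<open>2 * \<delta>\<close>.\<close>
      also have "\<epsilon> * \<bar>t - e\<bar> * norm T \<le> \<epsilon> * (2 * \<delta>) * N"
        using that e ab \<epsilon> \<delta> by (intro mult_mono) (auto simp: N_def)
      also have "\<dots> \<le> \<epsilon> * (r / 2)"
        using \<delta>(5) N \<epsilon> by (simp add: field_simps)
      also have "norm z \<le> r / 2 * \<epsilon>"
        using z \<delta>(4) \<epsilon> by (meson less_imp_le mult_right_mono order_trans)
      finally show ?thesis by (simp add: field_simps)
    qed
    have \<eta>r: "\<eta> t \<in> ball p r" if "t \<in> {a..b}" for t
    proof -
      have "r * \<epsilon> \<le> r * (1 / 2)" using \<epsilon> \<delta>(6) r(1) by (intro mult_left_mono) auto
      then have "dist (\<eta> t) (snd c (\<gamma> t)) \<le> r / 2" using near[OF that] by (simp add: dist_norm)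
      then show ?thesis
        using tt(4)[OF that] dist_triangle[of p "\<eta> t" "snd c (\<gamma> t)"] by (simp add: dist_commute)
    qed
    \<comment> \<open>The velocity is causal at the old point \<open>snd c (\<gamma> t)\<close>; the
      perturbation estimate carries it, once tilted, to the displaced point
      \<open>\<eta> t\<close>.\<close>
    have step: "coord_metric M c (\<eta> t) (v t c + \<epsilon> *\<^sub>R T) (v t c + \<epsilon> *\<^sub>R T) \<le> 0 \<and>
        coord_metric M c (\<eta> t) (v t c + \<epsilon> *\<^sub>R T) (\<tau> (\<eta> t)) < 0" if "t \<in> {a..b}" for t
      unfolding T_def
    proof (rule pert)
      show "snd c (\<gamma> t) \<in> ball p r" using tt(4)[OF that] r(1) by simp
      show "\<epsilon> < r" using \<epsilon>(2) \<delta>(4) r(1) by simp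
      show "coord_metric M c (snd c (\<gamma> t)) (v t c) (v t c) \<le> 0"
        using causal[OF tt(1)[OF that]] metric_eq_coord_metric[OF c(1) tt(3)[OF that]] vt[OF tt(1)[OF that]]
        by (simp add: causal_vector_def)
    qed (use \<eta>r that tt near \<epsilon> in auto)
    have "causal_step M (chart_inv c (\<eta> a)) (chart_inv c (\<eta> b))"
    proof (rule causal_step_chart[OF c(1) ab(2)])
      fix t assume t: "t \<in> {a..b}"
      have "((\<lambda>s. snd c (\<gamma> s)) has_vector_derivative v t c) (at t within {a..b})"
        by (rule has_vector_derivative_within_subset[OF C1_curveD(3)[OF \<gamma> c(1)]]) (use tt[OF t] ab in auto)
      moreover have "((\<lambda>t. \<epsilon> *\<^sub>R (t - e) *\<^sub>R T) has_vector_derivative \<epsilon> *\<^sub>R T) (at t within {a..b})"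
        by (auto intro!: derivative_eq_intros simp: has_vector_derivative_def)
      ultimately show "(\<eta> has_vector_derivative v t c + \<epsilon> *\<^sub>R T) (at t within {a..b})"
        unfolding \<eta>_def by (auto intro!: derivative_eq_intros)
      show "\<eta> t \<in> snd c ` fst c" using \<eta>r[OF t] r(2) by (auto simp: S_def)
    next
      show "continuous_on {a..b} (\<lambda>t. v t c + \<epsilon> *\<^sub>R T)"
        by (intro continuous_intros continuous_on_subset[OF C1_curveD(4)[OF \<gamma> c(1)]]) (use tt in auto)
    qed (use step in \<open>auto simp: \<tau>_def\<close>)
    then show "causal_step M (chart_inv c (snd c (\<gamma> a) + \<epsilon> *\<^sub>R (a - e) *\<^sub>R T + z))
         (chart_inv c (snd c (\<gamma> b) + \<epsilon> *\<^sub>R (b - e) *\<^sub>R T + z))"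
      by (simp add: \<eta>_def)
  qed
qed

section \<open>Futures and pasts as closure operators\<close>

lemma J_plus_increasing: "U \<subseteq> J_plus M U" and J_minus_increasing: "U \<subseteq> J_minus M U"
  by (auto simp: J_plus_def J_minus_def intro: causal_le_refl)

lemma J_plus_idem: "J_plus M (J_plus M U) = J_plus M U"
proof
  show "J_plus M (J_plus M U) \<subseteq> J_plus M U"
    unfolding J_plus_def using causal_le_trans[of M] by blast
qed (rule J_plus_increasing)

lemma J_minus_idem: "J_minus M (J_minus M U) = J_minus M U"
proof
  show "J_minus M (J_minus M U) \<subseteq> J_minus M U"
    unfolding J_minus_def using causal_le_trans[of M] by blast
qed (rule J_minus_increasing)

lemma J_plus_mono: "U \<subseteq> V \<Longrightarrow> J_plus M U \<subseteq> J_plus M V"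
  and J_minus_mono: "U \<subseteq> V \<Longrightarrow> J_minus M U \<subseteq> J_minus M V"
  unfolding J_plus_def J_minus_def by blast+

text \<open>A transitive form of openness, which can be proved piecewise along a curve.\<close>

definition openly_linked :: "'m \<Rightarrow> 'm \<Rightarrow> bool" where
  "openly_linked x y \<longleftrightarrow>
     (\<forall>U. open U \<and> x \<in> U \<longrightarrow> (\<exists>W. open W \<and> y \<in> W \<and> W \<subseteq> J_plus M U)) \<and>
     (\<forall>V. open V \<and> y \<in> V \<longrightarrow> (\<exists>W. open W \<and> x \<in> W \<and> W \<subseteq> J_minus M V))"

lemma openly_linked_refl: "openly_linked x x"
  unfolding openly_linked_def using J_plus_increasing J_minus_increasing by blast

text \<open>The neighbourhood of \<open>y\<close> produced by one link is the given neighbourhood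
  for the other; idempotence of \<open>J_plus\<close> and \<open>J_minus\<close> absorbs the second
  cone.\<close>

lemma openly_linked_trans:
  assumes "openly_linked x y" "openly_linked y z"
  shows "openly_linked x z"
  unfolding openly_linked_def
proof (intro conjI allI impI; elim conjE)
  fix U assume "open U" "x \<in> U"
  then obtain W where W: "open W" "y \<in> W" "W \<subseteq> J_plus M U"
    using assms(1) unfolding openly_linked_def by blast
  then obtain W' where "open W'" "z \<in> W'" "W' \<subseteq> J_plus M W"
    using assms(2) unfolding openly_linked_def by blast
  with J_plus_mono[OF W(3)] show "\<exists>W. open W \<and> z \<in> W \<and> W \<subseteq> J_plus M U"
    unfolding J_plus_idem by blast
next
  fix V assume "open V" "z \<in> V"
  then obtain W where W: "open W" "y \<in> W" "W \<subseteq> J_minus M V"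
    using assms(2) unfolding openly_linked_def by blast
  then obtain W' where "open W'" "x \<in> W'" "W' \<subseteq> J_minus M W"
    using assms(1) unfolding openly_linked_def by blast
  with J_minus_mono[OF W(3)] show "\<exists>W. open W \<and> x \<in> W \<and> W \<subseteq> J_minus M V"
    unfolding J_minus_idem by blast
qed

text \<open>With \<open>e = b\<close> the perturbed curves end at every point of a neighbourhood of
  \<open>\<gamma> b\<close>, while a small \<open>\<epsilon>\<close> keeps their starting points in
  \<open>U\<close>. With \<open>e = a\<close> the roles of the ends are exchanged.\<close>

lemma openly_linked_local:
  assumes \<gamma>: "C1_curve M s s' \<gamma> v" and t0: "t0 \<in> {s..s'}"
    and causal: "\<And>t. t \<in> {s..s'} \<Longrightarrow> causal_vector M (\<gamma> t) (v t) \<and> future_directed M (\<gamma> t) (v t)"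
  obtains \<delta> where "\<delta> > 0"
    "\<And>a b. s \<le> a \<Longrightarrow> a \<le> b \<Longrightarrow> b \<le> s' \<Longrightarrow> \<bar>a - t0\<bar> < \<delta> \<Longrightarrow> \<bar>b - t0\<bar> < \<delta> \<Longrightarrow> openly_linked (\<gamma> a) (\<gamma> b)"
proof -
  obtain c T \<delta> where c: "c \<in> atlas M" and \<delta>: "\<delta> > 0"
    and in_c: "\<And>t. t \<in> {s..s'} \<Longrightarrow> \<bar>t - t0\<bar> < \<delta> \<Longrightarrow> \<gamma> t \<in> fst c"
    and step: "\<And>a b e \<epsilon> z. s \<le> a \<Longrightarrow> a < b \<Longrightarrow> b \<le> s' \<Longrightarrow> \<bar>a - t0\<bar> < \<delta> \<Longrightarrow> \<bar>b - t0\<bar> < \<delta> \<Longrightarrow> e \<in> {a..b} \<Longrightarrow>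
       0 < \<epsilon> \<Longrightarrow> \<epsilon> < \<delta> \<Longrightarrow> norm z \<le> \<delta> * \<epsilon> \<Longrightarrow>
       causal_step M (chart_inv c (snd c (\<gamma> a) + \<epsilon> *\<^sub>R (a - e) *\<^sub>R T + z))
         (chart_inv c (snd c (\<gamma> b) + \<epsilon> *\<^sub>R (b - e) *\<^sub>R T + z))"
    by (rule causal_curve_perturbation[OF \<gamma> t0 causal]; (assumption | (rule that; assumption)))
  note ch = is_chart_M[OF c]
  text \<open>The scale \<open>\<epsilon>\<close> at which all perturbations move the point \<open>q\<close> only inside \<open>U\<close>.\<close>
  have scale: "\<exists>\<epsilon>>0. \<epsilon> < \<delta> \<and> (\<forall>z. norm z \<le> \<delta> * \<epsilon> \<longrightarrow> chart_inv c (snd c q + \<epsilon> *\<^sub>R w + z) \<in> U)"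
    if U: "open U" "q \<in> U" and q: "q \<in> fst c" for q w U
  proof -
    have "open (snd c ` (fst c \<inter> U))" by (rule open_chart_image[OF ch U(1)])
    moreover have "snd c q \<in> snd c ` (fst c \<inter> U)" using U(2) q by blast
    ultimately obtain \<rho> where \<rho>: "\<rho> > 0" "ball (snd c q) \<rho> \<subseteq> snd c ` (fst c \<inter> U)"
      by (rule openE)
    \<comment> \<open>The displacement \<open>\<epsilon> *\<^sub>R w + z\<close> has norm at most
      \<open>\<epsilon> * R\<close>.\<close>
    define R where "R = norm w + \<delta>"
    have R: "R > 0" using \<delta> by (simp add: R_def add_nonneg_pos)
    define \<epsilon> where "\<epsilon> = min (\<delta> / 2) (\<rho> / 2 / R)"
    have \<epsilon>: "0 < \<epsilon>" "\<epsilon> < \<delta>" "\<epsilon> * R < \<rho>"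
    proof -
      show "0 < \<epsilon>" "\<epsilon> < \<delta>" using \<delta> \<rho>(1) R by (auto simp: \<epsilon>_def)
      have "\<epsilon> * R \<le> \<rho> / 2 / R * R" using R by (intro mult_right_mono) (auto simp: \<epsilon>_def)
      then show "\<epsilon> * R < \<rho>" using R \<rho>(1) by simp
    qed
    have "chart_inv c (snd c q + \<epsilon> *\<^sub>R w + z) \<in> U" if "norm z \<le> \<delta> * \<epsilon>" for z
    proof -
      have "norm (\<epsilon> *\<^sub>R w + z) \<le> \<epsilon> * norm w + norm z"
        using norm_triangle_ineq[of "\<epsilon> *\<^sub>R w" z] \<epsilon>(1) by simp
      also have "\<dots> \<le> \<epsilon> * R" using that by (simp add: R_def algebra_simps)
      finally have "dist (snd c q) (snd c q + \<epsilon> *\<^sub>R w + z) < \<rho>"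
        using \<epsilon>(3) by (simp add: dist_norm norm_minus_commute add.assoc add.commute[of z])
      then have "snd c q + \<epsilon> *\<^sub>R w + z \<in> snd c ` (fst c \<inter> U)" using \<rho>(2) by auto
      then show ?thesis using chart_inv_chart[OF ch] by auto
    qed
    then show ?thesis using \<epsilon> by blast
  qed
  show thesis
  proof (rule that[OF \<delta>])
    fix a b assume ab: "s \<le> a" "a \<le> b" "b \<le> s'" "\<bar>a - t0\<bar> < \<delta>" "\<bar>b - t0\<bar> < \<delta>"
    show "openly_linked (\<gamma> a) (\<gamma> b)"
    proof (cases "a = b")
      case False
      then have lt: "a < b" using ab(2) by simp
      have ac: "\<gamma> a \<in> fst c" and bc: "\<gamma> b \<in> fst c" using in_c ab by auto
      have W: "open (fst c \<inter> snd c -` ball (snd c q) (\<delta> * \<epsilon>))" for q \<epsilon>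
        by (rule open_chart_vimage[OF ch]) simp
      show ?thesis
        unfolding openly_linked_def
      proof (intro conjI allI impI; elim conjE)
        fix U assume U: "open U" "\<gamma> a \<in> U"
        obtain \<epsilon> where \<epsilon>: "\<epsilon> > 0" "\<epsilon> < \<delta>"
          "\<And>z. norm z \<le> \<delta> * \<epsilon> \<Longrightarrow> chart_inv c (snd c (\<gamma> a) + \<epsilon> *\<^sub>R (a - b) *\<^sub>R T + z) \<in> U"
          using scale[OF U ac, of "(a - b) *\<^sub>R T"] by blast
        have "y \<in> J_plus M U" if "y \<in> fst c \<inter> snd c -` ball (snd c (\<gamma> b)) (\<delta> * \<epsilon>)" for y
        proof -
          \<comment> \<open>The translation that takes the end \<open>\<gamma> b\<close> to
            \<open>y\<close>; the radius \<open>\<delta> * \<epsilon>\<close> of the neighbourhood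
            is exactly the range allowed for it.\<close>
          define z where "z = snd c y - snd c (\<gamma> b)"
          have z: "norm z \<le> \<delta> * \<epsilon>" using that by (simp add: z_def dist_norm norm_minus_commute)
          have "causal_step M (chart_inv c (snd c (\<gamma> a) + \<epsilon> *\<^sub>R (a - b) *\<^sub>R T + z)) y"
            using step[OF ab(1) lt ab(3-5) _ \<epsilon>(1,2) z, of b] lt that by (simp add: z_def chart_inv_chart[OF ch])
          then show ?thesis
            using \<epsilon>(3)[OF z] unfolding J_plus_def by (blast intro: causal_step_imp_causal_le)
        qed
        moreover have "\<gamma> b \<in> fst c \<inter> snd c -` ball (snd c (\<gamma> b)) (\<delta> * \<epsilon>)" using bc \<delta> \<epsilon>(1) by simp
        ultimately show "\<exists>W. open W \<and> \<gamma> b \<in> W \<and> W \<subseteq> J_plus M U" using W by blast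
      next
        fix V assume V: "open V" "\<gamma> b \<in> V"
        obtain \<epsilon> where \<epsilon>: "\<epsilon> > 0" "\<epsilon> < \<delta>"
          "\<And>z. norm z \<le> \<delta> * \<epsilon> \<Longrightarrow> chart_inv c (snd c (\<gamma> b) + \<epsilon> *\<^sub>R (b - a) *\<^sub>R T + z) \<in> V"
          using scale[OF V bc, of "(b - a) *\<^sub>R T"] by blast
        have "x \<in> J_minus M V" if "x \<in> fst c \<inter> snd c -` ball (snd c (\<gamma> a)) (\<delta> * \<epsilon>)" for x
        proof -
          define z where "z = snd c x - snd c (\<gamma> a)"
          have z: "norm z \<le> \<delta> * \<epsilon>" using that by (simp add: z_def dist_norm norm_minus_commute)
          have "causal_step M x (chart_inv c (snd c (\<gamma> b) + \<epsilon> *\<^sub>R (b - a) *\<^sub>R T + z))"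
            using step[OF ab(1) lt ab(3-5) _ \<epsilon>(1,2) z, of a] lt that by (simp add: z_def chart_inv_chart[OF ch])
          then show ?thesis
            using \<epsilon>(3)[OF z] unfolding J_minus_def by (blast intro: causal_step_imp_causal_le)
        qed
        moreover have "\<gamma> a \<in> fst c \<inter> snd c -` ball (snd c (\<gamma> a)) (\<delta> * \<epsilon>)" using ac \<delta> \<epsilon>(1) by simp
        ultimately show "\<exists>W. open W \<and> \<gamma> a \<in> W \<and> W \<subseteq> J_minus M V" using W by blast
      qed
    qed (simp add: openly_linked_refl)
  qed
qed

text \<open>Bolzano's bisection principle joins the local links along the compact parameter
  interval, by transitivity of \<open>openly_linked\<close>.\<close>

lemma causal_step_openly_linked:
  assumes "causal_step M x y"
  shows "openly_linked x y"
proof -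
  obtain s s' \<gamma> v where \<gamma>: "s < s'" "C1_curve M s s' \<gamma> v" "\<gamma> s = x" "\<gamma> s' = y"
    "\<And>t. t \<in> {s..s'} \<Longrightarrow> causal_vector M (\<gamma> t) (v t) \<and> future_directed M (\<gamma> t) (v t)"
    using assms unfolding causal_step_def by blast
  have "s \<le> s'" using \<gamma>(1) by simp
  \<comment> \<open>The local case of the bisection principle ranges over intervals that may stick
    out of \<open>{s..s'}\<close>; the two guards make the claim vacuous for those.\<close>
  then have "s \<le> s \<longrightarrow> s' \<le> s' \<longrightarrow> openly_linked (\<gamma> s) (\<gamma> s')"
  proof (induction rule: Bolzano[where P = "\<lambda>a b. s \<le> a \<longrightarrow> b \<le> s' \<longrightarrow> openly_linked (\<gamma> a) (\<gamma> b)"])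
    case (trans a b c)
    then show ?case by (auto intro: openly_linked_trans)
  next
    case (local t)
    then have "t \<in> {s..s'}" by simp
    then obtain \<delta> where "\<delta> > 0"
      "\<And>a b. s \<le> a \<Longrightarrow> a \<le> b \<Longrightarrow> b \<le> s' \<Longrightarrow> \<bar>a - t\<bar> < \<delta> \<Longrightarrow> \<bar>b - t\<bar> < \<delta> \<Longrightarrow> openly_linked (\<gamma> a) (\<gamma> b)"
      using openly_linked_local[OF \<gamma>(2) _ \<gamma>(5)] by blast
    then show ?case by (intro exI[of _ \<delta>]) auto
  qed
  then show ?thesis using \<gamma>(3,4) by simp
qed

lemma causal_le_openly_linked: "causal_le M x y \<Longrightarrow> openly_linked x y"
  unfolding causal_le_eq_rtranclp
proof (induction rule: rtranclp_induct)
  case (step y z)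
  then show ?case by (intro openly_linked_trans[OF step.IH] causal_step_openly_linked)
qed (rule openly_linked_refl)

lemma open_J_plus:
  assumes "open U"
  shows "open (J_plus M U)"
proof (subst open_subopen, intro ballI)
  fix y assume "y \<in> J_plus M U"
  then obtain x where "x \<in> U" "causal_le M x y" unfolding J_plus_def by blast
  then show "\<exists>W. open W \<and> y \<in> W \<and> W \<subseteq> J_plus M U"
    using causal_le_openly_linked[of x y] assms unfolding openly_linked_def by simp
qed

lemma open_J_minus:
  assumes "open V"
  shows "open (J_minus M V)"
proof (subst open_subopen, intro ballI)
  fix x assume "x \<in> J_minus M V"
  then obtain y where "y \<in> V" "causal_le M x y" unfolding J_minus_def by blast
  then show "\<exists>W. open W \<and> x \<in> W \<and> W \<subseteq> J_minus M V"
    using causal_le_openly_linked[of x y] assms unfolding openly_linked_def by simp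
qed

section \<open>The localic cones and their images\<close>

text \<open>Being open and containing \<open>U\<close>, the set \<open>J_plus M U\<close> is itself
  one of the sets in the union; \<open>open_le\<close> puts all the others inside it.\<close>

lemma up_cone_eq_J_plus:
  assumes "open U"
  shows "up_cone M U = J_plus M U"
proof
  have "open_le M U (J_plus M U)"
    unfolding open_le_def using J_plus_increasing J_minus_increasing by blast
  then show "J_plus M U \<subseteq> up_cone M U"
    unfolding up_cone_def using open_J_plus[OF assms] by blast
qed (auto simp: up_cone_def open_le_def)

lemma down_cone_eq_J_minus:
  assumes "open U"
  shows "down_cone M U = J_minus M U"
proof
  have "open_le M (J_minus M U) U"
    unfolding open_le_def using J_plus_increasing J_minus_increasing by blast
  then show "J_minus M U \<subseteq> down_cone M U"
    unfolding down_cone_def using open_J_minus[OF assms] by blast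
qed (auto simp: down_cone_def open_le_def)

text \<open>The image of an extensive idempotent operator is its set of fixed points.\<close>

lemma up_cone_image: "up_cone M ` {U. open U} = {U. open U \<and> J_plus M U \<subseteq> U}"
proof safe
  fix U :: "'m set" and x assume "open U"
  then show "open (up_cone M U)" "x \<in> J_plus M (up_cone M U) \<Longrightarrow> x \<in> up_cone M U"
    using open_J_plus J_plus_idem by (auto simp: up_cone_eq_J_plus)
next
  fix U :: "'m set" assume "open U" "J_plus M U \<subseteq> U"
  then show "U \<in> up_cone M ` {U. open U}"
    using up_cone_eq_J_plus[of U] J_plus_increasing[of U] by (intro image_eqI[of _ _ U]) auto
qed

lemma down_cone_image: "down_cone M ` {U. open U} = {U. open U \<and> J_minus M U \<subseteq> U}"
proof safe
  fix U :: "'m set" and x assume "open U"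
  then show "open (down_cone M U)" "x \<in> J_minus M (down_cone M U) \<Longrightarrow> x \<in> down_cone M U"
    using open_J_minus J_minus_idem by (auto simp: down_cone_eq_J_minus)
next
  fix U :: "'m set" assume "open U" "J_minus M U \<subseteq> U"
  then show "U \<in> down_cone M ` {U. open U}"
    using down_cone_eq_J_minus[of U] J_minus_increasing[of U] by (intro image_eqI[of _ _ U]) auto
qed

lemma strongly_causal_iff:
  "strongly_causal M \<longleftrightarrow> (\<forall>W\<in>{U. open U}. \<forall>x\<in>W.
     \<exists>a\<in>up_cone M ` {U. open U}. \<exists>b\<in>down_cone M ` {U. open U}. x \<in> a \<inter> b \<and> a \<inter> b \<subseteq> W)"
proof (intro iffI ballI)
  fix W :: "'m set" and x assume sc: "strongly_causal M" and "W \<in> {U. open U}" "x \<in> W"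
  then obtain U where U: "open U" "x \<in> U" "U \<subseteq> W" "causally_convex M U"
    unfolding strongly_causal_def by blast
  have "J_plus M U \<inter> J_minus M U \<subseteq> U"
    using U(4) unfolding causally_convex_def J_plus_def J_minus_def by blast
  then have "x \<in> up_cone M U \<inter> down_cone M U \<and> up_cone M U \<inter> down_cone M U \<subseteq> W"
    using U J_plus_increasing[of U] J_minus_increasing[of U]
    by (auto simp: up_cone_eq_J_plus down_cone_eq_J_minus)
  with U(1) show "\<exists>a\<in>up_cone M ` {U. open U}. \<exists>b\<in>down_cone M ` {U. open U}. x \<in> a \<inter> b \<and> a \<inter> b \<subseteq> W"
    by blast
next
  assume base: "\<forall>W\<in>{U. open U}. \<forall>x\<in>W.
     \<exists>a\<in>up_cone M ` {U. open U}. \<exists>b\<in>down_cone M ` {U. open U}. x \<in> a \<inter> b \<and> a \<inter> b \<subseteq> W"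
  show "strongly_causal M"
    unfolding strongly_causal_def
  proof (intro allI impI; elim conjE)
    fix x and V :: "'m set" assume "open V" "x \<in> V"
    then have "V \<in> {U. open U}" by simp
    from base[rule_format, OF this \<open>x \<in> V\<close>]
    obtain a b where "a \<in> up_cone M ` {U. open U}" "b \<in> down_cone M ` {U. open U}"
      and x: "x \<in> a \<inter> b" "a \<inter> b \<subseteq> V"
      by (elim bexE conjE)
    then have ab: "open a" "J_plus M a \<subseteq> a" "open b" "J_minus M b \<subseteq> b"
      unfolding up_cone_image down_cone_image by simp_all
    \<comment> \<open>\<open>z\<close> is above a point of the up-set \<open>a\<close> and below a
      point of the down-set \<open>b\<close>.\<close>
    have "z \<in> a \<inter> b" if "y \<in> a \<inter> b" "y' \<in> a \<inter> b" "causal_le M y z" "causal_le M z y'" for y y' z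
    proof -
      have "z \<in> J_plus M a" "z \<in> J_minus M b"
        using that unfolding J_plus_def J_minus_def by blast+
      then show ?thesis using ab(2,4) by blast
    qed
    then have "causally_convex M (a \<inter> b)"
      unfolding causally_convex_def by blast
    with ab x show "\<exists>U. open U \<and> x \<in> U \<and> U \<subseteq> V \<and> causally_convex M U"
      by (intro exI[of _ "a \<inter> b"]) auto
  qed
qed

text \<open>Upward closure passes to unions and intersections, so the open up-sets form a topology
  coarser than that of the manifold.\<close>

lemma topology_frame_futures: "topology_frame (up_cone M ` {U. open U})"
  unfolding up_cone_image
proof
  show "istopology (\<lambda>U. U \<in> {U. open U \<and> J_plus M U \<subseteq> U})"
    unfolding istopology_def mem_Collect_eq J_plus_def by (intro conjI allI impI) (blast intro: open_Int open_Union)+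
qed simp

lemma topology_frame_pasts: "topology_frame (down_cone M ` {U. open U})"
  unfolding down_cone_image
proof
  show "istopology (\<lambda>U. U \<in> {U. open U \<and> J_minus M U \<subseteq> U})"
    unfolding istopology_def mem_Collect_eq J_minus_def by (intro conjI allI impI) (blast intro: open_Int open_Union)+
qed simp

end

lemma topology_frame_opens: "topology_frame {U :: 'a::topological_space set. open U}"
  by (standard) (auto simp: istopology_def)

theorem theorem6p30:
  fixes M :: "('m::{t2_space,second_countable_topology}, 'e::euclidean_space) spacetime"
  assumes "smooth_spacetime M"
  shows "strongly_causal M \<longleftrightarrow>
    defines_sublocale opens_locale (locale_prod (locale_of_futures M) (locale_of_pasts M))
      (canonical_map M)"
proof -
  have "up_cone M ` {U. open U} \<subseteq> {U. open U}" "down_cone M ` {U. open U} \<subseteq> {U. open U}"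
    unfolding up_cone_image[OF assms] down_cone_image[OF assms] by auto
  \<comment> \<open>Sublocale and strong causality are now equivalent to the same basis
    condition.\<close>
  from defines_sublocale_pairing_iff[OF topology_frame_opens topology_frame_futures[OF assms] this(1)
      topology_frame_pasts[OF assms] this(2)]
  show ?thesis
    unfolding strongly_causal_iff[OF assms] canonical_map_def opens_locale_def locale_of_futures_def
      locale_of_pasts_def ..
qed

end
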